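(* Let $\mathcal A$ be a $C^*$-algebra. 1) Let $\mathcal M$ be a Hilbert $\mathcal A$-module. A bounded $\mathcal A$-morphism $F:\mathcal M\to\ell^2(\mathcal A)$ is locally adjointable if and only if all its projections $\pi_k\circ F:\mathcal M\to\mathcal A$, $k\in\mathbb N$, are locally adjointable. 2) A bounded $\mathcal A$-endomorphism $F$ of $\ell^2(\mathcal A)$ is locally adjointable if and only if all its matrix rows belong to $(M(\ell^2(\mathcal A)))'$.
   Context: All modules are right Hilbert $C^*$-modules, with inner products conjugate-linear in the first variable and satisfying $\langle x,ya\rangle=\langle x,y\rangle a$. An operator $F:\mathcal M\to\mathcal N$ (bounded $\mathcal A$-homomorphism) is adjointable if there is $F^*:\mathcal N\to\mathcal M$ with $\langle Fx,y\rangle=\langle x,F^*y\rangle$ for all $x,y$. The algebra $\mathcal A$ is a Hilbert $\mathcal A$-module with $\langle a,b\rangle=a^*b$. A bounded $\mathcal A$-morphism $F:\mathcal M\to\mathcal N$ is locally adjointable if for every adjointable $\gamma:\mathcal A\to\mathcal M$ the composition $F\circ\gamma:\mathcal A\to\mathcal N$ is adjointable. An $\mathcal A$-functional on $\mathcal M$ is a bounded $\mathcal A$-homomorphism $\mathcal M\to\mathcal A$. $\ell^2(\mathcal A)$ is the module of sequences $a=(a_1,a_2,\dots)$ in $\mathcal A$ with $\sum_i a_i^*a_i$ norm-convergent, with $\langle a,b\rangle=\sum_i a_i^*b_i$; $\pi_k:\ell^2(\mathcal A)\to\mathcal A$ is the projection $a\mapsto a_k$. $\mathcal A$ is assumed faithfully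 and non-degenerately represented on a Hilbert space $H$; $LM(\mathcal A)=\{T\in B(H): Ta\in\mathcal A\ \forall a\in \mathcal A\}$, $RM(\mathcal A)=\{T\in B(H): aT\in\mathcal A\ \forall a\in \mathcal A\}$ and $M(\mathcal A)=LM(\mathcal A)\cap RM(\mathcal A)$ are the left, right and two-sided multipliers. Left strict convergence $T_\lambda\to T$ means $\|T_\lambda a-Ta\|\to0$ for every $a\in\mathcal A$. Known fact (Bakić): every $\mathcal A$-functional $\Gamma$ on $\ell^2(\mathcal A)$ is given by a unique sequence of coefficients $\Gamma_i\in RM(\mathcal A)$ such that $\sum_i\Gamma_i^*\Gamma_i$ converges strongly in $B(H)$, acting by $\Gamma(x)=\sum_i\Gamma_i^*x_i$ (norm-convergent). The $k$-th matrix row of a bounded $\mathcal A$-endomorphism $F$ of $\ell^2(\mathcal A)$ is the functional $\pi_k\circ F$, identified with its sequence of coefficients $\{\Gamma^{(k)}_i\}_i$, so $\pi_k(F(x))=\sum_i(\Gamma^{(k)}_i)^*x_i$. $M(\ell^2(\mathcal A))$ (the multiplier module) is the Hilbert $M(\mathcal A)$-module of all adjointable maps $r:\mathcal A\to\ell^2(\mathcal A)$, with inner product $\langle r_1,r_2\rangle=r_1^*r_2\in M(\mathcal A)$. It is identified with the set of sequences $\beta=\{\beta_i\}$ in $M(\mathcal A)$ such that $\sum_i\beta_i^*\beta_i$ is strictly convergent, $\beta$ corresponding to the map $a\mapsto(\beta_1a,\beta_2a,\dots)$. Its dual module $(M(\ell^2(\mathcal A)))'$ is the set of bounded $M(\mathcal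 A)$-homomorphisms $M(\ell^2(\mathcal A))\to M(\mathcal A)$. A sequence $\{\alpha_i\}$ belongs to (determines an element of) $(M(\ell^2(\mathcal A)))'$ if all $\alpha_i\in M(\mathcal A)$ and: 1) the partial sums of $\sum_i\alpha_i^*\alpha_i$ are bounded, i.e. this series converges strongly in $B(H)$; 2) for any $\beta=\{\beta_i\}\in M(\ell^2(\mathcal A))$ the series $\sum_i\alpha_i^*\beta_i$ is left strictly convergent; 3) its limit (a priori in $LM(\mathcal A)$) belongs to $M(\mathcal A)$. The corresponding element is $\beta\mapsto\sum_i\alpha_i^*\beta_i$. *)

theory Defs
  imports "HOL-Analysis.Analysis" "HOL-Library.Function_Algebras"
begin

section \<open>Complex Hilbert spaces and bounded operators\<close>

class scaleC =
  fixes scaleC :: "complex \<Rightarrow> 'a \<Rightarrow> 'a"  (infixr \<open>*\<^sub>C\<close> 75)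

class complex_vector = scaleC + ab_group_add +
  assumes scaleC_add_right: "c *\<^sub>C (x + y) = c *\<^sub>C x + c *\<^sub>C y"
    and scaleC_add_left: "(c + d) *\<^sub>C x = c *\<^sub>C x + d *\<^sub>C x"
    and scaleC_scaleC: "c *\<^sub>C d *\<^sub>C x = (c * d) *\<^sub>C x"
    and scaleC_one: "1 *\<^sub>C x = x"

text \<open>Norm, topology and completeness come from the underlying real inner product
  \<open>x \<bullet> y = Re \<langle>x, y\<rangle>\<close>; in particular \<open>\<parallel>x\<parallel>\<^sup>2 = \<langle>x, x\<rangle>\<close>.
  The complex inner product is conjugate-linear in the first variable.\<close>

class chilbert_space = real_inner + complete_space + complex_vector +
  fixes cinner :: "'a \<Rightarrow> 'a \<Rightarrow> complex"
  assumes scaleR_scaleC: "r *\<^sub>R x = complex_of_real r *\<^sub>C x"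
    and cinner_add_right: "cinner x (y + z) = cinner x y + cinner x z"
    and cinner_scaleC_right: "cinner x (c *\<^sub>C y) = c * cinner x y"
    and cinner_commute: "cinner y x = cnj (cinner x y)"
    and inner_eq_Re_cinner: "x \<bullet> y = Re (cinner x y)"
begin

lemma cinner_scaleC_left: "cinner (c *\<^sub>C x) y = cnj c * cinner x y"
  by (metis cinner_commute cinner_scaleC_right complex_cnj_mult)

lemma cinner_self: "cinner x x = complex_of_real ((norm x)\<^sup>2)"
proof (rule complex_eqI)
  show "Re (cinner x x) = Re (complex_of_real ((norm x)\<^sup>2))"
    using inner_eq_Re_cinner[of x x] by (simp add: power2_norm_eq_inner)
  have "Im (cinner x x) = - Im (cinner x x)"
    by (subst cinner_commute) (rule cnj.simps(2))
  then show "Im (cinner x x) = Im (complex_of_real ((norm x)\<^sup>2))"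
    by simp
qed

lemma norm_scaleC: "norm (c *\<^sub>C x) = cmod c * norm x"
proof -
  have "complex_of_real ((norm (c *\<^sub>C x))\<^sup>2) = cnj c * c * complex_of_real ((norm x)\<^sup>2)"
    by (metis cinner_self cinner_scaleC_left cinner_scaleC_right mult.assoc mult.commute)
  also have "\<dots> = complex_of_real ((cmod c * norm x)\<^sup>2)"
    using complex_norm_square[of c] by (simp add: power_mult_distrib mult.commute)
  finally have "(norm (c *\<^sub>C x))\<^sup>2 = (cmod c * norm x)\<^sup>2"
    using of_real_eq_iff by blast
  then show ?thesis
    by (simp add: power2_eq_iff_nonneg)
qed

end

instantiation blinfun :: (real_normed_vector, chilbert_space) complex_vector
begin

lift_definition scaleC_blinfun :: "complex \<Rightarrow> 'a \<Rightarrow>\<^sub>L 'b \<Rightarrow> 'a \<Rightarrow>\<^sub>L 'b"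
  is "\<lambda>c T x. c *\<^sub>C T x"
proof -
  fix c :: complex and T :: "'a \<Rightarrow> 'b"
  assume "bounded_linear T"
  then interpret T: bounded_linear T .
  obtain K where K: "\<And>x. norm (T x) \<le> norm x * K"
    using T.bounded by blast
  show "bounded_linear (\<lambda>x. c *\<^sub>C T x)"
  proof (rule bounded_linear_intro)
    show "c *\<^sub>C T (x + y) = c *\<^sub>C T x + c *\<^sub>C T y" for x y
      by (simp add: T.add scaleC_add_right)
    show "c *\<^sub>C T (r *\<^sub>R x) = r *\<^sub>R (c *\<^sub>C T x)" for r x
      by (simp add: T.scaleR scaleR_scaleC scaleC_scaleC mult.commute)
    show "norm (c *\<^sub>C T x) \<le> norm x * (cmod c * K)" for x
      using mult_left_mono[OF K[of x] norm_ge_zero[of c]]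
      by (simp add: norm_scaleC mult.left_commute)
  qed
qed

instance
  by standard
    (transfer; simp add: fun_eq_iff scaleC_add_right scaleC_add_left scaleC_scaleC scaleC_one)+

end

instantiation "fun" :: (type, complex_vector) complex_vector
begin

definition scaleC_fun :: "complex \<Rightarrow> ('a \<Rightarrow> 'b) \<Rightarrow> 'a \<Rightarrow> 'b"
  where "scaleC_fun c f = (\<lambda>x. c *\<^sub>C f x)"

instance
  by standard
    (simp_all add: scaleC_fun_def fun_eq_iff scaleC_add_right scaleC_add_left scaleC_scaleC
      scaleC_one)

end

text \<open>The type \<open>'h op\<close> contains all bounded real-linear operators;
  \<open>B(H)\<close> is the subset of the complex-linear ones.\<close>

type_synonym 'h op = "'h \<Rightarrow>\<^sub>L 'h"

definition BH :: "'h::chilbert_space op set"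
  where "BH = {T. \<forall>c x. blinfun_apply T (c *\<^sub>C x) = c *\<^sub>C blinfun_apply T x}"

definition adj :: "'h::chilbert_space op \<Rightarrow> 'h op"
  where "adj T = (THE S. S \<in> BH \<and>
    (\<forall>x y. cinner (blinfun_apply T x) y = cinner x (blinfun_apply S y)))"

definition positive_op :: "'h::chilbert_space op \<Rightarrow> bool"
  where "positive_op T \<longleftrightarrow> T \<in> BH \<and> (\<forall>x. cinner x (blinfun_apply T x) \<in> \<real>\<^sub>\<ge>\<^sub>0)"

definition strongly_summable :: "(nat \<Rightarrow> 'h::chilbert_space op) \<Rightarrow> bool"
  where "strongly_summable f \<longleftrightarrow>
    (\<exists>T\<in>BH. \<forall>x. (\<lambda>i. blinfun_apply (f i) x) sums blinfun_apply T x)"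


section \<open>Represented \<open>C\<^sup>*\<close>-algebras and their multipliers\<close>

text \<open>A faithfully and non-degenerately represented \<open>C\<^sup>*\<close>-algebra is identified with
  its image in \<open>B(H)\<close>. The real span below is already a complex subspace.\<close>

locale represented_cstar_algebra =
  fixes A :: "'h::chilbert_space op set"
  assumes subset_BH: "A \<subseteq> BH"
    and zero_mem: "0 \<in> A"
    and add_mem: "a \<in> A \<Longrightarrow> b \<in> A \<Longrightarrow> a + b \<in> A"
    and scaleC_mem: "a \<in> A \<Longrightarrow> c *\<^sub>C a \<in> A"
    and mult_mem: "a \<in> A \<Longrightarrow> b \<in> A \<Longrightarrow> a o\<^sub>L b \<in> A"
    and adj_mem: "a \<in> A \<Longrightarrow> adj a \<in> A"
    and norm_closed: "closed A"
    and nondegenerate: "closure (span {blinfun_apply a x | a x. a \<in> A}) = UNIV"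

definition LM :: "'h::chilbert_space op set \<Rightarrow> 'h op set"
  where "LM A = {T \<in> BH. \<forall>a\<in>A. T o\<^sub>L a \<in> A}"

definition RM :: "'h::chilbert_space op set \<Rightarrow> 'h op set"
  where "RM A = {T \<in> BH. \<forall>a\<in>A. a o\<^sub>L T \<in> A}"

definition Mult :: "'h::chilbert_space op set \<Rightarrow> 'h op set"
  where "Mult A = LM A \<inter> RM A"

definition left_strict_sums ::
    "'h::chilbert_space op set \<Rightarrow> (nat \<Rightarrow> 'h op) \<Rightarrow> 'h op \<Rightarrow> bool"
  where "left_strict_sums A f T \<longleftrightarrow> (\<forall>a\<in>A. (\<lambda>i. f i o\<^sub>L a) sums (T o\<^sub>L a))"

definition strict_sums ::
    "'h::chilbert_space op set \<Rightarrow> (nat \<Rightarrow> 'h op) \<Rightarrow> 'h op \<Rightarrow> bool"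
  where "strict_sums A f T \<longleftrightarrow>
    (\<forall>a\<in>A. (\<lambda>i. f i o\<^sub>L a) sums (T o\<^sub>L a) \<and> (\<lambda>i. a o\<^sub>L f i) sums (a o\<^sub>L T))"


section \<open>Hilbert \<open>C\<^sup>*\<close>-modules\<close>

text \<open>The additive group and the complex scalars are those of the type \<open>'m\<close>.\<close>

record (overloaded) ('m, 'h) cstar_module =
  carr :: "'m set"
  act :: "'m \<Rightarrow> 'h op \<Rightarrow> 'm"
  ip :: "'m \<Rightarrow> 'm \<Rightarrow> 'h op"

definition mnorm :: "('m, 'h::chilbert_space) cstar_module \<Rightarrow> 'm \<Rightarrow> real"
  where "mnorm M x = sqrt (norm (ip M x x))"

locale hilbert_module =
  fixes A :: "'h::chilbert_space op set"
    and M :: "('m::complex_vector, 'h) cstar_module"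
  assumes zero_carr: "0 \<in> carr M"
    and add_carr: "x \<in> carr M \<Longrightarrow> y \<in> carr M \<Longrightarrow> x + y \<in> carr M"
    and scaleC_carr: "x \<in> carr M \<Longrightarrow> c *\<^sub>C x \<in> carr M"
    and act_carr: "x \<in> carr M \<Longrightarrow> a \<in> A \<Longrightarrow> act M x a \<in> carr M"
    and act_add_left:
      "x \<in> carr M \<Longrightarrow> y \<in> carr M \<Longrightarrow> a \<in> A \<Longrightarrow> act M (x + y) a = act M x a + act M y a"
    and act_add_right:
      "x \<in> carr M \<Longrightarrow> a \<in> A \<Longrightarrow> b \<in> A \<Longrightarrow> act M x (a + b) = act M x a + act M x b"
    and act_mult:
      "x \<in> carr M \<Longrightarrow> a \<in> A \<Longrightarrow> b \<in> A \<Longrightarrow> act M x (a o\<^sub>L b) = act M (act M x a) b"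
    and act_scaleC_left:
      "x \<in> carr M \<Longrightarrow> a \<in> A \<Longrightarrow> act M (c *\<^sub>C x) a = c *\<^sub>C act M x a"
    and act_scaleC_right:
      "x \<in> carr M \<Longrightarrow> a \<in> A \<Longrightarrow> act M x (c *\<^sub>C a) = c *\<^sub>C act M x a"
    and ip_mem: "x \<in> carr M \<Longrightarrow> y \<in> carr M \<Longrightarrow> ip M x y \<in> A"
    and ip_add_right:
      "x \<in> carr M \<Longrightarrow> y \<in> carr M \<Longrightarrow> z \<in> carr M \<Longrightarrow> ip M x (y + z) = ip M x y + ip M x z"
    and ip_scaleC_right:
      "x \<in> carr M \<Longrightarrow> y \<in> carr M \<Longrightarrow> ip M x (c *\<^sub>C y) = c *\<^sub>C ip M x y"
    and ip_act_right:
      "x \<in> carr M \<Longrightarrow> y \<in> carr M \<Longrightarrow> a \<in> A \<Longrightarrow> ip M x (act M y a) = ip M x y o\<^sub>L a"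
    and ip_adj: "x \<in> carr M \<Longrightarrow> y \<in> carr M \<Longrightarrow> ip M y x = adj (ip M x y)"
    and ip_positive: "x \<in> carr M \<Longrightarrow> positive_op (ip M x x)"
    and ip_definite: "x \<in> carr M \<Longrightarrow> ip M x x = 0 \<Longrightarrow> x = 0"
    and complete:
      "\<lbrakk>\<And>n. X n \<in> carr M;
        \<And>e. e > 0 \<Longrightarrow> \<exists>N. \<forall>m\<ge>N. \<forall>n\<ge>N. mnorm M (X m - X n) < e\<rbrakk>
       \<Longrightarrow> \<exists>x\<in>carr M. (\<lambda>n::nat. mnorm M (X n - x)) \<longlonglongrightarrow> 0"

definition bounded_hom ::
    "'h::chilbert_space op set \<Rightarrow> ('m::complex_vector, 'h) cstar_module \<Rightarrow>
     ('n::complex_vector, 'h) cstar_module \<Rightarrow> ('m \<Rightarrow> 'n) \<Rightarrow> bool"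
  where "bounded_hom A M N F \<longleftrightarrow>
    (\<forall>x\<in>carr M. F x \<in> carr N) \<and>
    (\<forall>x\<in>carr M. \<forall>y\<in>carr M. F (x + y) = F x + F y) \<and>
    (\<forall>c. \<forall>x\<in>carr M. F (c *\<^sub>C x) = c *\<^sub>C F x) \<and>
    (\<forall>x\<in>carr M. \<forall>a\<in>A. F (act M x a) = act N (F x) a) \<and>
    (\<exists>K. \<forall>x\<in>carr M. mnorm N (F x) \<le> K * mnorm M x)"

definition adjointable ::
    "'h::chilbert_space op set \<Rightarrow> ('m::complex_vector, 'h) cstar_module \<Rightarrow>
     ('n::complex_vector, 'h) cstar_module \<Rightarrow> ('m \<Rightarrow> 'n) \<Rightarrow> bool"
  where "adjointable A M N F \<longleftrightarrow> bounded_hom A M N F \<and>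
    (\<exists>G. (\<forall>y\<in>carr N. G y \<in> carr M) \<and>
         (\<forall>x\<in>carr M. \<forall>y\<in>carr N. ip N (F x) y = ip M x (G y)))"

definition alg_module :: "'h::chilbert_space op set \<Rightarrow> ('h op, 'h) cstar_module"
  where "alg_module A = \<lparr>carr = A, act = (\<lambda>x a. x o\<^sub>L a), ip = (\<lambda>a b. adj a o\<^sub>L b)\<rparr>"

definition locally_adjointable ::
    "'h::chilbert_space op set \<Rightarrow> ('m::complex_vector, 'h) cstar_module \<Rightarrow>
     ('n::complex_vector, 'h) cstar_module \<Rightarrow> ('m \<Rightarrow> 'n) \<Rightarrow> bool"
  where "locally_adjointable A M N F \<longleftrightarrow> bounded_hom A M N F \<and>
    (\<forall>\<gamma>. adjointable A (alg_module A) M \<gamma> \<longrightarrow> adjointable A (alg_module A) N (F \<circ> \<gamma>))"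


section \<open>The standard module and its multiplier module\<close>

text \<open>Sequences are indexed from 0.\<close>

definition l2 :: "'h::chilbert_space op set \<Rightarrow> (nat \<Rightarrow> 'h op, 'h) cstar_module"
  where "l2 A = \<lparr>
    carr = {x. (\<forall>i. x i \<in> A) \<and> summable (\<lambda>i. adj (x i) o\<^sub>L x i)},
    act = (\<lambda>x a i. x i o\<^sub>L a),
    ip = (\<lambda>x y. \<Sum>i. adj (x i) o\<^sub>L y i)\<rparr>"

definition proj :: "nat \<Rightarrow> (nat \<Rightarrow> 'h op) \<Rightarrow> 'h::chilbert_space op"
  where "proj k x = x k"

definition is_coefficients ::
    "'h::chilbert_space op set \<Rightarrow> ((nat \<Rightarrow> 'h op) \<Rightarrow> 'h op) \<Rightarrow> (nat \<Rightarrow> 'h op) \<Rightarrow> bool"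
  where "is_coefficients A \<phi> \<Gamma> \<longleftrightarrow>
    (\<forall>i. \<Gamma> i \<in> RM A) \<and>
    strongly_summable (\<lambda>i. adj (\<Gamma> i) o\<^sub>L \<Gamma> i) \<and>
    (\<forall>x\<in>carr (l2 A). (\<lambda>i. adj (\<Gamma> i) o\<^sub>L x i) sums \<phi> x)"

text \<open>Every bounded \<open>A\<close>-functional on \<open>\<ell>\<^sup>2(A)\<close> has exactly one sequence of coefficients
  (a theorem of Bakic), so the description below is proper for bounded endomorphisms \<open>F\<close>.\<close>

definition matrix_row ::
    "'h::chilbert_space op set \<Rightarrow> ((nat \<Rightarrow> 'h op) \<Rightarrow> (nat \<Rightarrow> 'h op)) \<Rightarrow> nat \<Rightarrow> (nat \<Rightarrow> 'h op)"
  where "matrix_row A F k = (THE \<Gamma>. is_coefficients A (proj k \<circ> F) \<Gamma>)"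

text \<open>The multiplier module \<open>M(\<ell>\<^sup>2(A))\<close> of adjointable maps \<open>A \<rightarrow> \<ell>\<^sup>2(A)\<close>, in its description
  by sequences: \<open>\<beta>\<close> stands for the map \<open>a \<mapsto> (\<beta>\<^sub>i a)\<^sub>i\<close>.\<close>

definition multiplier_l2 :: "'h::chilbert_space op set \<Rightarrow> (nat \<Rightarrow> 'h op) set"
  where "multiplier_l2 A = {\<beta>. (\<forall>i. \<beta> i \<in> Mult A) \<and>
    (\<exists>T\<in>Mult A. strict_sums A (\<lambda>i. adj (\<beta> i) o\<^sub>L \<beta> i) T)}"

text \<open>The sequences determining an element \<open>\<beta> \<mapsto> \<Sum>\<^sub>i \<alpha>\<^sub>i\<^sup>* \<beta>\<^sub>i\<close> of \<open>M(\<ell>\<^sup>2(A))'\<close>.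
  Left strict limits are unique by non-degeneracy.\<close>

definition multiplier_l2_dual :: "'h::chilbert_space op set \<Rightarrow> (nat \<Rightarrow> 'h op) set"
  where "multiplier_l2_dual A = {\<alpha>. (\<forall>i. \<alpha> i \<in> Mult A) \<and>
    bounded (range (\<lambda>n. \<Sum>i<n. adj (\<alpha> i) o\<^sub>L \<alpha> i)) \<and>
    (\<forall>\<beta>\<in>multiplier_l2 A. \<exists>T\<in>Mult A. left_strict_sums A (\<lambda>i. adj (\<alpha> i) o\<^sub>L \<beta> i) T)}"

end

theory Submission
  imports Defs
begin

text \<open>
  Both parts rest on one fact: a bounded homomorphism \<open>\<gamma> : A \<rightarrow> \<ell>\<^sup>2(A)\<close> is adjointable as soon as all its
  components are (\<open>adjointable_standard_module_iff\<close>). An adjointable map \<open>A \<rightarrow> A\<close> is left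
  multiplication by a two-sided multiplier (\<open>adjointable_algebra_iff\<close>), so \<open>\<gamma> a = (\<beta>\<^sub>i a)\<^sub>i\<close> with
  multipliers \<open>\<beta>\<^sub>i\<close>. Boundedness of \<open>\<gamma>\<close>, tested on an approximate unit, says that the column
  \<open>h \<mapsto> (\<beta>\<^sub>i h)\<^sub>i\<close> is bounded on the Hilbert space. Hence the row \<open>y \<mapsto> \<Sum>\<^sub>i \<beta>\<^sub>i\<^sup>* y\<^sub>i\<close> converges in norm for
  every \<open>y\<close> in \<open>\<ell>\<^sup>2(A)\<close> (\<open>summable_row_times_column\<close>), and this row is the adjoint of \<open>\<gamma>\<close>. With \<open>y = \<gamma> a\<close>
  one sees that \<open>\<Sum>\<^sub>i \<beta>\<^sub>i\<^sup>* \<beta>\<^sub>i\<close> converges strictly, so adjointable maps \<open>A \<rightarrow> \<ell>\<^sup>2(A)\<close> are exactly the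
  elements of the multiplier module (\<open>multiplier_column\<close>, \<open>adjointable_multiplier_l2\<close>).

  The first part follows by applying this to \<open>F \<circ> \<gamma>\<close> for every adjointable \<open>\<gamma>\<close>. It reduces the second
  part to functionals: a functional \<open>\<phi>\<close> with coefficients \<open>\<Gamma>\<^sub>i\<close> sends the map given by \<open>\<beta>\<close> to
  \<open>a \<mapsto> \<Sum>\<^sub>i \<Gamma>\<^sub>i\<^sup>* \<beta>\<^sub>i a\<close>, which is adjointable if and only if the left strict sum of \<open>\<Gamma>\<^sub>i\<^sup>* \<beta>\<^sub>i\<close> is a two-sided
  multiplier (\<open>locally_adjointable_functional_iff\<close>).

  The description of functionals by coefficients (\<open>coefficients_exist\<close>, \<open>coefficients_unique\<close>) and of
  homomorphisms \<open>A \<rightarrow> A\<close> by left multipliers (\<open>left_multiplier_exists\<close>) is obtained from a bounded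
  approximate unit, whose elements are polynomials \<open>1 - (1 - b)\<^sup>n\<close> in positive elements \<open>b\<close>; their
  convergence is an elementary estimate on the moments of \<open>1 - b\<close> (\<open>moment_difference_bound\<close>).
\<close>

section \<open>Adjoints of bounded operators\<close>

instance chilbert_space \<subseteq> banach ..

text \<open>The representing vector minimises the quadratic functional \<open>x \<mapsto> \<parallel>x\<parallel>\<^sup>2 - 2 f x\<close>; by the
  parallelogram law every minimising sequence of it is Cauchy.\<close>

lemma riesz_representation:
  fixes f :: "'a::{real_inner, complete_space} \<Rightarrow> real"
  assumes "bounded_linear f"
  obtains v where "\<And>x. f x = v \<bullet> x"
proof -
  interpret f: bounded_linear f by fact
  obtain K where K: "\<And>x. norm (f x) \<le> norm x * K"
    using f.bounded by blast
  define q where "q x = (norm x)\<^sup>2 - 2 * f x" for x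
  have lower: "- K\<^sup>2 \<le> q x" for x
  proof -
    have "0 \<le> (norm x - K)\<^sup>2"
      by simp
    moreover have "f x \<le> norm x * K"
      using K[of x] by (simp add: abs_le_iff)
    ultimately show ?thesis
      by (simp add: q_def power2_diff)
  qed
  then have bdd: "bdd_below (range q)"
    by (intro bdd_belowI2[where m="- K\<^sup>2"]) auto
  define I where "I = Inf (range q)"
  have I_le: "I \<le> q x" for x
    unfolding I_def by (rule cInf_lower) (use bdd in auto)
  have "\<exists>x. q x < I + 1 / real (Suc n)" for n
    using cInf_lessD[of "range q" "I + 1 / real (Suc n)"] by (auto simp: I_def)
  then obtain X where X: "\<And>n. q (X n) < I + 1 / real (Suc n)"
    by metis
  have parallelogram: "(norm (x - y))\<^sup>2 \<le> 2 * (q x - I) + 2 * (q y - I)" for x y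
  proof -
    define m where "m = (1/2) *\<^sub>R (x + y)"
    have "(norm (x - y))\<^sup>2 = 2 * q x + 2 * q y - 4 * q m"
      by (simp add: q_def m_def power2_norm_eq_inner f.scaleR f.add inner_add inner_diff
          inner_commute field_simps)
    moreover have "4 * I \<le> 4 * q m"
      using I_le[of m] by simp
    ultimately show ?thesis
      unfolding right_diff_distrib by simp
  qed
  have "Cauchy X"
  proof (rule metric_CauchyI)
    fix e :: real
    assume e: "e > 0"
    then obtain N where N: "4 / e\<^sup>2 < real N"
      using reals_Archimedean2 by blast
    have "dist (X m) (X n) < e" if "m \<ge> N" "n \<ge> N" for m n
    proof -
      have small: "1 / real (Suc k) < e\<^sup>2 / 4" if "k \<ge> N" for k
      proof -
        have "4 / e\<^sup>2 < real (Suc k)"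
          using N that by linarith
        then show ?thesis
          using e by (simp add: field_simps)
      qed
      have near: "q (X k) - I < e\<^sup>2 / 4" if "k \<ge> N" for k
        using X[of k] small[OF that] by simp
      have "2 * (q (X m) - I) + 2 * (q (X n) - I) < e\<^sup>2"
        using near[OF that(1)] near[OF that(2)] by simp
      then have "(norm (X m - X n))\<^sup>2 < e\<^sup>2"
        by (rule le_less_trans[OF parallelogram])
      then show ?thesis
        using e by (simp add: dist_norm power2_less_imp_less)
    qed
    then show "\<exists>N. \<forall>m\<ge>N. \<forall>n\<ge>N. dist (X m) (X n) < e"
      by blast
  qed
  then obtain v where v: "X \<longlonglongrightarrow> v"
    using Cauchy_convergent convergent_def by blast
  have "(\<lambda>n. q (X n)) \<longlonglongrightarrow> q v"
    unfolding q_def by (intro tendsto_intros f.tendsto v)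
  moreover have "(\<lambda>n. I + 1 / real (Suc n)) \<longlonglongrightarrow> I + 0"
    by (intro tendsto_intros LIMSEQ_Suc lim_1_over_n)
  ultimately have "q v \<le> I + 0"
    by (rule LIMSEQ_le) (use X less_imp_le in blast)
  then have minimal: "q v \<le> q x" for x
    using I_le[of x] by simp
  have "f y = v \<bullet> y" for y
  proof (rule ccontr)
    assume ne: "f y \<noteq> v \<bullet> y"
    define d where "d = f y - v \<bullet> y"
    have d: "d \<noteq> 0"
      using ne by (simp add: d_def)
    have y: "norm y > 0"
      using d by (auto simp: d_def)
    \<comment> \<open>the minimum of \<open>t \<mapsto> q (v + t y)\<close> is attained at this \<open>t\<close>\<close>
    define t where "t = d / (norm y)\<^sup>2"
    have "q (v + t *\<^sub>R y) = q v - 2 * t * d + t * (t * (norm y)\<^sup>2)"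
      by (simp add: q_def d_def power2_norm_eq_inner f.scaleR f.add inner_add
          inner_commute algebra_simps)
    also have "\<dots> = q v - d\<^sup>2 / (norm y)\<^sup>2"
      using y by (simp add: t_def power2_eq_square field_simps)
    finally have "q (v + t *\<^sub>R y) = q v - d\<^sup>2 / (norm y)\<^sup>2" .
    moreover have "d\<^sup>2 / (norm y)\<^sup>2 > 0"
      using d y by simp
    ultimately show False
      using minimal[of "v + t *\<^sub>R y"] by simp
  qed
  then show thesis
    using that by blast
qed

lemma Re_cinner: "Re (cinner x y) = x \<bullet> (y::'h::chilbert_space)"
  by (simp add: inner_eq_Re_cinner)

lemma Im_cinner: "Im (cinner x y) = - (x \<bullet> (\<i> *\<^sub>C (y::'h::chilbert_space)))"
  by (simp add: inner_eq_Re_cinner cinner_scaleC_right)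

lemma inner_scaleC_right: "x \<bullet> (c *\<^sub>C y) = (cnj c *\<^sub>C x) \<bullet> (y::'h::chilbert_space)"
  by (simp add: inner_eq_Re_cinner cinner_scaleC_right cinner_scaleC_left)

lemma bounded_linear_scaleC: "bounded_linear (\<lambda>x::'h::chilbert_space. c *\<^sub>C x)"
proof (rule bounded_linear_intro)
  show "c *\<^sub>C (x + y) = c *\<^sub>C x + c *\<^sub>C y" for x y :: 'h
    by (rule scaleC_add_right)
  show "c *\<^sub>C (r *\<^sub>R x) = r *\<^sub>R (c *\<^sub>C x)" for r and x :: 'h
    by (simp add: scaleR_scaleC scaleC_scaleC mult.commute)
  show "norm (c *\<^sub>C x) \<le> norm x * cmod c" for x :: 'h
    by (simp add: norm_scaleC mult.commute)
qed

lemmas tendsto_scaleC = bounded_linear.tendsto[OF bounded_linear_scaleC]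

lemma scaleC_blinfun_apply [simp]: "blinfun_apply (c *\<^sub>C T) x = c *\<^sub>C blinfun_apply T x"
  by (simp add: scaleC_blinfun.rep_eq)

lemma scaleR_blinfun_scaleC: "r *\<^sub>R T = complex_of_real r *\<^sub>C (T::'h::chilbert_space op)"
  by (rule blinfun_eqI) (simp add: scaleR_scaleC scaleR_blinfun.rep_eq)

lemma BH_scaleC: "T \<in> BH \<Longrightarrow> blinfun_apply T (c *\<^sub>C x) = c *\<^sub>C blinfun_apply T x"
  by (simp add: BH_def)

lemma zero_BH [simp]: "0 \<in> BH"
  by (simp add: BH_def linear_0[OF bounded_linear.linear, OF bounded_linear_scaleC])

lemma id_BH [simp]: "id_blinfun \<in> BH"
  by (simp add: BH_def)

lemma add_BH: "S \<in> BH \<Longrightarrow> T \<in> BH \<Longrightarrow> S + T \<in> BH"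
  by (simp add: BH_def blinfun.add_left scaleC_add_right)

lemma compose_BH: "S \<in> BH \<Longrightarrow> T \<in> BH \<Longrightarrow> S o\<^sub>L T \<in> BH"
  by (simp add: BH_def)

lemma sum_BH: "(\<And>i. i \<in> I \<Longrightarrow> f i \<in> BH) \<Longrightarrow> sum f I \<in> BH"
  by (induction I rule: infinite_finite_induct) (auto intro: add_BH)

lemma real_adjoint_exists:
  fixes T :: "'h::chilbert_space op"
  obtains S :: "'h op" where "\<And>x y. blinfun_apply T x \<bullet> y = x \<bullet> blinfun_apply S y"
proof -
  have "\<exists>v. \<forall>x. blinfun_apply T x \<bullet> y = x \<bullet> v" for y
  proof -
    have "bounded_linear (\<lambda>x. blinfun_apply T x \<bullet> y)"
      by (intro bounded_linear_intros)
    then show ?thesis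
      by (rule riesz_representation[where thesis="\<exists>v. \<forall>x. blinfun_apply T x \<bullet> y = x \<bullet> v"])
        (metis inner_commute)
  qed
  then obtain s where s: "\<And>x y. blinfun_apply T x \<bullet> y = x \<bullet> s y"
    by metis
  have ext: "u = v" if "\<And>x. x \<bullet> u = x \<bullet> v" for u v :: 'h
    using that vector_eq_ldot by blast
  have "bounded_linear s"
  proof (rule bounded_linear_intro)
    show "s (y + z) = s y + s z" for y z
      by (rule ext) (metis s inner_add_right)
    show "s (r *\<^sub>R y) = r *\<^sub>R s y" for r y
      by (rule ext) (metis s inner_scaleR_right)
    show "norm (s y) \<le> norm y * norm T" for y
    proof (cases "s y = 0")
      case False
      have "norm (s y) * norm (s y) = blinfun_apply T (s y) \<bullet> y"
        using s[of "s y" y] by (simp add: power2_norm_eq_inner[symmetric] power2_eq_square)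
      also have "\<dots> \<le> norm (blinfun_apply T (s y)) * norm y"
        by (rule norm_cauchy_schwarz)
      also have "\<dots> \<le> norm T * norm (s y) * norm y"
        by (intro mult_right_mono norm_blinfun norm_ge_zero)
      finally show ?thesis
        using False by (simp add: mult.commute mult.left_commute)
    qed simp
  qed
  then show thesis
    using that[of "Blinfun s"] s by (simp add: bounded_linear_Blinfun_apply)
qed

text \<open>For complex-linear operators the adjoint with respect to \<open>cinner\<close> is the adjoint with respect
  to the real inner product, so that all estimates can be made with the latter.\<close>

lemma real_adjoint_is_adj:
  assumes T: "T \<in> BH" and S: "\<And>x y. blinfun_apply T x \<bullet> y = x \<bullet> blinfun_apply S y"
  shows "S \<in> BH" and "adj T = S"
proof -
  have ext: "u = v" if "\<And>x. x \<bullet> u = x \<bullet> v" for u v :: 'a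
    using that vector_eq_ldot by blast
  have S_scaleC: "blinfun_apply S (c *\<^sub>C y) = c *\<^sub>C blinfun_apply S y" for c y
    by (rule ext) (metis S inner_scaleC_right BH_scaleC[OF T])
  then show BH: "S \<in> BH"
    by (simp add: BH_def)
  have cinner: "cinner (blinfun_apply T x) y = cinner x (blinfun_apply S y)" for x y
    by (rule complex_eqI) (simp_all add: Re_cinner Im_cinner S S_scaleC)
  show "adj T = S"
    unfolding adj_def
  proof (rule the_equality)
    fix S'
    assume "S' \<in> BH \<and> (\<forall>x y. cinner (blinfun_apply T x) y = cinner x (blinfun_apply S' y))"
    then have "x \<bullet> blinfun_apply S' y = x \<bullet> blinfun_apply S y" for x y
      by (metis Re_cinner S)
    then show "S' = S"
      by (intro blinfun_eqI ext)
  qed (use BH cinner in blast)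
qed

lemma
  assumes "T \<in> BH"
  shows adj_BH: "adj T \<in> BH"
    and inner_adj: "blinfun_apply T x \<bullet> y = x \<bullet> blinfun_apply (adj T) y"
proof -
  obtain S where S: "\<And>x y. blinfun_apply T x \<bullet> y = x \<bullet> blinfun_apply S y"
    using real_adjoint_exists[of T] by blast
  show "adj T \<in> BH" "blinfun_apply T x \<bullet> y = x \<bullet> blinfun_apply (adj T) y"
    using real_adjoint_is_adj[OF assms S] S by simp_all
qed

lemma inner_adj': "T \<in> BH \<Longrightarrow> blinfun_apply (adj T) x \<bullet> y = x \<bullet> blinfun_apply T y"
  by (metis inner_adj inner_commute)

lemma adj_eqI:
  assumes "T \<in> BH" "\<And>x y. blinfun_apply T x \<bullet> y = x \<bullet> blinfun_apply S y"
  shows "adj T = S"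
  using assms by (rule real_adjoint_is_adj)

lemma adj_adj [simp]: "T \<in> BH \<Longrightarrow> adj (adj T) = T"
  by (rule adj_eqI) (simp_all add: adj_BH inner_adj')

lemma adj_zero [simp]: "adj 0 = 0"
  by (rule adj_eqI) simp_all

lemma adj_compose: "S \<in> BH \<Longrightarrow> T \<in> BH \<Longrightarrow> adj (S o\<^sub>L T) = adj T o\<^sub>L adj S"
  by (rule adj_eqI) (simp_all add: compose_BH inner_adj)

lemma adj_add: "S \<in> BH \<Longrightarrow> T \<in> BH \<Longrightarrow> adj (S + T) = adj S + adj T"
  by (rule adj_eqI) (simp_all add: add_BH inner_adj blinfun.add_left inner_add)

lemma adj_sum:
  "(\<And>i. i \<in> I \<Longrightarrow> f i \<in> BH) \<Longrightarrow> adj (sum f I) = (\<Sum>i\<in>I. adj (f i))"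
  by (induction I rule: infinite_finite_induct) (simp_all add: adj_add sum_BH)

lemma norm_adj [simp]:
  assumes "T \<in> BH"
  shows "norm (adj T) = norm T"
proof -
  have le: "norm (adj S) \<le> norm S" if S: "S \<in> BH" for S :: "'a op"
  proof (rule norm_blinfun_bound)
    fix x
    let ?y = "blinfun_apply (adj S) x"
    show "norm ?y \<le> norm S * norm x"
    proof (cases "?y = 0")
      case False
      have "norm ?y * norm ?y = x \<bullet> blinfun_apply S ?y"
        using inner_adj'[OF S, of x ?y] by (simp add: power2_norm_eq_inner[symmetric] power2_eq_square)
      also have "\<dots> \<le> norm x * norm (blinfun_apply S ?y)"
        by (rule norm_cauchy_schwarz)
      also have "\<dots> \<le> norm x * (norm S * norm ?y)"
        by (intro mult_left_mono norm_blinfun norm_ge_zero)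
      finally show ?thesis
        using False by (simp add: mult.commute mult.left_commute)
    qed simp
  qed simp
  show ?thesis
    using le[OF assms] le[OF adj_BH[OF assms]] assms by simp
qed

lemma norm_adj_compose_self:
  assumes T: "T \<in> BH"
  shows "norm (adj T o\<^sub>L T) = (norm T)\<^sup>2"
proof (rule antisym)
  show "norm (adj T o\<^sub>L T) \<le> (norm T)\<^sup>2"
    using norm_blinfun_compose[of "adj T" T] T by (simp add: power2_eq_square)
  have "norm T \<le> sqrt (norm (adj T o\<^sub>L T))"
  proof (rule norm_blinfun_bound)
    fix x
    have "(norm (blinfun_apply T x))\<^sup>2 = x \<bullet> blinfun_apply (adj T o\<^sub>L T) x"
      by (simp add: power2_norm_eq_inner inner_adj[OF T])
    also have "\<dots> \<le> norm x * (norm (adj T o\<^sub>L T) * norm x)"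
      by (intro order_trans[OF norm_cauchy_schwarz] mult_left_mono norm_blinfun norm_ge_zero)
    also have "\<dots> = (sqrt (norm (adj T o\<^sub>L T)) * norm x)\<^sup>2"
      by (simp add: power_mult_distrib power2_eq_square)
    finally show "norm (blinfun_apply T x) \<le> sqrt (norm (adj T o\<^sub>L T)) * norm x"
      by (rule power2_le_imp_le) simp
  qed simp
  then show "(norm T)\<^sup>2 \<le> norm (adj T o\<^sub>L T)"
    using power_mono[OF _ norm_ge_zero, of T _ 2] by fastforce
qed

lemma diff_BH: "S \<in> BH \<Longrightarrow> T \<in> BH \<Longrightarrow> S - T \<in> BH"
  by (simp add: BH_def blinfun.diff_left
      linear_diff[OF bounded_linear.linear, OF bounded_linear_scaleC])

lemma adj_diff: "S \<in> BH \<Longrightarrow> T \<in> BH \<Longrightarrow> adj (S - T) = adj S - adj T"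
  by (rule adj_eqI) (simp_all add: diff_BH inner_adj blinfun.diff_left inner_diff)

lemma adj_sums:
  assumes f: "\<And>i. f i \<in> BH" and s: "s \<in> BH" and sums: "f sums s"
  shows "(\<lambda>i. adj (f i)) sums adj s"
proof -
  have "norm ((\<Sum>i<n. adj (f i)) - adj s) = norm ((\<Sum>i<n. f i) - s)" for n
  proof -
    have "(\<Sum>i<n. adj (f i)) - adj s = adj ((\<Sum>i<n. f i) - s)"
      by (simp add: adj_diff adj_sum sum_BH f s)
    then show ?thesis
      by (simp add: diff_BH sum_BH f s)
  qed
  then show ?thesis
    using sums unfolding sums_def LIMSEQ_iff by simp
qed

lemma compose_assoc: "(S o\<^sub>L T) o\<^sub>L R = S o\<^sub>L (T o\<^sub>L R)"
  by (rule blinfun_eqI) simp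

lemmas compose_add_right = bounded_bilinear.add_right[OF bounded_bilinear_blinfun_compose]

lemmas sums_compose_left =
  bounded_linear.sums[OF bounded_bilinear.bounded_linear_right[OF bounded_bilinear_blinfun_compose]]

section \<open>Columns of operators\<close>

text \<open>A sequence of operators \<open>a i\<close> is column-bounded by \<open>C\<close> when the column \<open>h \<mapsto> (a i h)\<^sub>i\<close> is
  bounded by \<open>C\<close> as an operator from \<open>H\<close> to the Hilbert sum of countably many copies of \<open>H\<close>. The
  bound is tested on vectors, where Cauchy-Schwarz is elementary; both the norm of \<open>\<ell>\<^sup>2(A)\<close> and the
  boundedness of coefficient sequences take this form.\<close>

definition column_bounded :: "real \<Rightarrow> (nat \<Rightarrow> 'h::chilbert_space op) \<Rightarrow> bool"
  where "column_bounded C a \<longleftrightarrow>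
    (\<forall>i. a i \<in> BH) \<and> (\<forall>n h. (\<Sum>i<n. (norm (blinfun_apply (a i) h))\<^sup>2) \<le> (C * norm h)\<^sup>2)"

lemma column_bounded_BH: "column_bounded C a \<Longrightarrow> a i \<in> BH"
  by (simp add: column_bounded_def)

lemma column_bounded_finite:
  assumes "column_bounded C a" "finite I"
  shows "(\<Sum>i\<in>I. (norm (blinfun_apply (a i) h))\<^sup>2) \<le> (C * norm h)\<^sup>2"
proof -
  obtain n where "I \<subseteq> {..<n}"
    using finite_nat_iff_bounded assms(2) by blast
  then have "(\<Sum>i\<in>I. (norm (blinfun_apply (a i) h))\<^sup>2)
      \<le> (\<Sum>i<n. (norm (blinfun_apply (a i) h))\<^sup>2)"
    by (intro sum_mono2) auto
  also have "\<dots> \<le> (C * norm h)\<^sup>2"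
    using assms(1) by (simp add: column_bounded_def)
  finally show ?thesis .
qed

text \<open>The adjoint of a bounded column is a row with the same bound.\<close>

lemma row_vector_bound:
  assumes a: "column_bounded C a" and C: "C \<ge> 0" and I: "finite I"
  shows "norm (\<Sum>i\<in>I. blinfun_apply (adj (a i)) (w i)) \<le> C * sqrt (\<Sum>i\<in>I. (norm (w i))\<^sup>2)"
proof -
  define v where "v = (\<Sum>i\<in>I. blinfun_apply (adj (a i)) (w i))"
  have "norm v * norm v = v \<bullet> v"
    by (simp add: power2_norm_eq_inner[symmetric] power2_eq_square)
  also have "v \<bullet> v = (\<Sum>i\<in>I. v \<bullet> blinfun_apply (adj (a i)) (w i))"
    by (subst (2) v_def) (rule inner_sum_right)
  also have "\<dots> = (\<Sum>i\<in>I. blinfun_apply (a i) v \<bullet> w i)"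
    by (intro sum.cong refl) (simp add: inner_adj[OF column_bounded_BH[OF a]])
  also have "\<dots> \<le> (\<Sum>i\<in>I. \<bar>norm (blinfun_apply (a i) v)\<bar> * \<bar>norm (w i)\<bar>)"
    by (intro sum_mono) (simp add: norm_cauchy_schwarz)
  also have "\<dots> \<le> L2_set (\<lambda>i. norm (blinfun_apply (a i) v)) I * L2_set (\<lambda>i. norm (w i)) I"
    by (rule L2_set_mult_ineq)
  also have "\<dots> \<le> (C * norm v) * L2_set (\<lambda>i. norm (w i)) I"
    by (intro mult_right_mono) (auto simp: L2_set_def C intro!: real_le_lsqrt
        column_bounded_finite[OF a I] sum_nonneg)
  finally have "norm v * norm v \<le> norm v * (C * L2_set (\<lambda>i. norm (w i)) I)"
    by (simp add: mult_ac)
  then have "norm v \<le> C * L2_set (\<lambda>i. norm (w i)) I"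
    by (cases "norm v = 0") (auto simp: C L2_set_nonneg)
  then show ?thesis
    by (simp add: v_def L2_set_def)
qed

lemma inner_sum_adj_compose:
  assumes "\<And>i. i \<in> I \<Longrightarrow> y i \<in> BH"
  shows "h \<bullet> blinfun_apply (\<Sum>i\<in>I. adj (y i) o\<^sub>L y i) h = (\<Sum>i\<in>I. (norm (blinfun_apply (y i) h))\<^sup>2)"
  using assms by (simp add: blinfun.sum_left inner_sum_right power2_norm_eq_inner inner_adj)

lemma sum_norm_le_norm_sum_adj_compose:
  assumes "\<And>i. i \<in> I \<Longrightarrow> y i \<in> BH"
  shows "(\<Sum>i\<in>I. (norm (blinfun_apply (y i) h))\<^sup>2) \<le> norm (\<Sum>i\<in>I. adj (y i) o\<^sub>L y i) * (norm h)\<^sup>2"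
proof -
  have "(\<Sum>i\<in>I. (norm (blinfun_apply (y i) h))\<^sup>2) = h \<bullet> blinfun_apply (\<Sum>i\<in>I. adj (y i) o\<^sub>L y i) h"
    using assms by (simp add: inner_sum_adj_compose)
  also have "\<dots> \<le> norm h * (norm (\<Sum>i\<in>I. adj (y i) o\<^sub>L y i) * norm h)"
    by (intro order_trans[OF norm_cauchy_schwarz] mult_left_mono norm_blinfun norm_ge_zero)
  finally show ?thesis
    by (simp add: power2_eq_square mult_ac)
qed

lemma row_times_column_bound:
  assumes a: "column_bounded C a" and C: "C \<ge> 0" and I: "finite I" and y: "\<And>i. y i \<in> BH"
  shows "norm (\<Sum>i\<in>I. adj (a i) o\<^sub>L y i) \<le> C * sqrt (norm (\<Sum>i\<in>I. adj (y i) o\<^sub>L y i))"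
proof (rule norm_blinfun_bound)
  fix h
  have "norm (blinfun_apply (\<Sum>i\<in>I. adj (a i) o\<^sub>L y i) h)
      = norm (\<Sum>i\<in>I. blinfun_apply (adj (a i)) (blinfun_apply (y i) h))"
    by (simp add: blinfun.sum_left)
  also have "\<dots> \<le> C * sqrt (\<Sum>i\<in>I. (norm (blinfun_apply (y i) h))\<^sup>2)"
    by (rule row_vector_bound[OF a C I])
  also have "\<dots> \<le> C * sqrt (norm (\<Sum>i\<in>I. adj (y i) o\<^sub>L y i) * (norm h)\<^sup>2)"
    by (intro mult_left_mono C real_sqrt_le_mono sum_norm_le_norm_sum_adj_compose y)
  finally show "norm (blinfun_apply (\<Sum>i\<in>I. adj (a i) o\<^sub>L y i) h)
      \<le> C * sqrt (norm (\<Sum>i\<in>I. adj (y i) o\<^sub>L y i)) * norm h"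
    by (simp add: real_sqrt_mult)
qed (simp add: C)

lemma norm_sum_adj_compose_le:
  assumes a: "column_bounded C a" and C: "C \<ge> 0" and I: "finite I"
  shows "norm (\<Sum>i\<in>I. adj (a i) o\<^sub>L a i) \<le> C\<^sup>2"
proof (rule norm_blinfun_bound)
  fix h
  have "norm (blinfun_apply (\<Sum>i\<in>I. adj (a i) o\<^sub>L a i) h)
      = norm (\<Sum>i\<in>I. blinfun_apply (adj (a i)) (blinfun_apply (a i) h))"
    by (simp add: blinfun.sum_left)
  also have "\<dots> \<le> C * sqrt (\<Sum>i\<in>I. (norm (blinfun_apply (a i) h))\<^sup>2)"
    by (rule row_vector_bound[OF a C I])
  also have "\<dots> \<le> C * sqrt ((C * norm h)\<^sup>2)"
    by (intro mult_left_mono C real_sqrt_le_mono column_bounded_finite[OF a I])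
  finally show "norm (blinfun_apply (\<Sum>i\<in>I. adj (a i) o\<^sub>L a i) h) \<le> C\<^sup>2 * norm h"
    by (simp only: real_sqrt_abs) (simp add: C power2_eq_square mult_ac)
qed simp

lemma column_bounded_iff_partial_sums:
  assumes "\<And>i. a i \<in> BH" "C \<ge> 0"
  shows "column_bounded C a \<longleftrightarrow> (\<forall>n. norm (\<Sum>i<n. adj (a i) o\<^sub>L a i) \<le> C\<^sup>2)"
proof safe
  fix n
  assume "column_bounded C a"
  then show "norm (\<Sum>i<n. adj (a i) o\<^sub>L a i) \<le> C\<^sup>2"
    by (intro norm_sum_adj_compose_le assms) auto
next
  assume n: "\<forall>n. norm (\<Sum>i<n. adj (a i) o\<^sub>L a i) \<le> C\<^sup>2"
  show "column_bounded C a"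
    unfolding column_bounded_def
  proof (intro conjI allI assms)
    fix n h
    have "(\<Sum>i<n. (norm (blinfun_apply (a i) h))\<^sup>2)
        \<le> norm (\<Sum>i<n. adj (a i) o\<^sub>L a i) * (norm h)\<^sup>2"
      by (rule sum_norm_le_norm_sum_adj_compose) (rule assms)
    also have "\<dots> \<le> C\<^sup>2 * (norm h)\<^sup>2"
      by (intro mult_right_mono) (use n in auto)
    finally show "(\<Sum>i<n. (norm (blinfun_apply (a i) h))\<^sup>2) \<le> (C * norm h)\<^sup>2"
      by (simp add: power_mult_distrib)
  qed
qed

lemma summable_row_times_column:
  assumes a: "column_bounded C a" and C: "C \<ge> 0" and y: "\<And>i. y i \<in> BH"
    and sm: "summable (\<lambda>i. adj (y i) o\<^sub>L y i)"
  shows "summable (\<lambda>i. adj (a i) o\<^sub>L y i)"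
  unfolding summable_Cauchy
proof (intro allI impI)
  fix e :: real
  assume e: "e > 0"
  then have "(e / (C + 1))\<^sup>2 > 0"
    using C by simp
  then obtain N where N: "\<And>m n. m \<ge> N \<Longrightarrow> norm (\<Sum>i=m..<n. adj (y i) o\<^sub>L y i) < (e / (C + 1))\<^sup>2"
    using sm unfolding summable_Cauchy by meson
  have "norm (\<Sum>i=m..<n. adj (a i) o\<^sub>L y i) < e" if "m \<ge> N" for m n
  proof -
    have "norm (\<Sum>i=m..<n. adj (a i) o\<^sub>L y i) \<le> C * sqrt (norm (\<Sum>i=m..<n. adj (y i) o\<^sub>L y i))"
      by (rule row_times_column_bound[OF a C _ y]) simp
    also have "\<dots> \<le> C * (e / (C + 1))"
    proof (intro mult_left_mono C real_le_lsqrt)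
      show "norm (\<Sum>i=m..<n. adj (y i) o\<^sub>L y i) \<le> (e / (C + 1))\<^sup>2"
        using N[OF that] less_imp_le by blast
    qed (use e C in auto)
    also have "\<dots> < e"
      using e C by (simp add: field_simps)
    finally show ?thesis .
  qed
  then show "\<exists>N. \<forall>m\<ge>N. \<forall>n. norm (\<Sum>i=m..<n. adj (a i) o\<^sub>L y i) < e"
    by blast
qed

lemma column_bounded_summable:
  assumes y: "\<And>i. y i \<in> BH" and sm: "summable (\<lambda>i. adj (y i) o\<^sub>L y i)"
  shows "column_bounded (sqrt (norm (\<Sum>i. adj (y i) o\<^sub>L y i))) y"
  unfolding column_bounded_def
proof (intro conjI allI y)
  fix n h
  let ?S = "\<lambda>n. \<Sum>i<n. adj (y i) o\<^sub>L y i" and ?T = "\<Sum>i. adj (y i) o\<^sub>L y i"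
  have "(\<lambda>m. h \<bullet> blinfun_apply (?S m) h) \<longlonglongrightarrow> h \<bullet> blinfun_apply ?T h"
    by (intro tendsto_intros summable_LIMSEQ sm)
  moreover have "(\<Sum>i<n. (norm (blinfun_apply (y i) h))\<^sup>2) \<le> h \<bullet> blinfun_apply (?S m) h" if "m \<ge> n" for m
    using that by (simp add: inner_sum_adj_compose y) (intro sum_mono2, auto)
  ultimately have "(\<Sum>i<n. (norm (blinfun_apply (y i) h))\<^sup>2) \<le> h \<bullet> blinfun_apply ?T h"
    by (intro Lim_bounded2) auto
  also have "\<dots> \<le> norm h * (norm ?T * norm h)"
    by (intro order_trans[OF norm_cauchy_schwarz] mult_left_mono norm_blinfun norm_ge_zero)
  finally show "(\<Sum>i<n. (norm (blinfun_apply (y i) h))\<^sup>2) \<le> (sqrt (norm ?T) * norm h)\<^sup>2"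
    by (simp add: power_mult_distrib) (simp add: power2_eq_square mult_ac)
qed

text \<open>For a bounded column \<open>a\<close> the series \<open>\<Sum>\<^sub>i (a i)\<^sup>* (a i) h\<close> is the row applied to the
  square-summable sequence \<open>(a i h)\<^sub>i\<close>, hence it converges.\<close>

lemma column_bounded_strong_sum:
  assumes a: "column_bounded C a" and C: "C \<ge> 0"
  obtains T where "T \<in> BH" "adj T = T"
    "\<And>h. (\<lambda>i. blinfun_apply (adj (a i) o\<^sub>L a i) h) sums blinfun_apply T h"
proof -
  note BH = column_bounded_BH[OF a]
  define f where "f i h = blinfun_apply (adj (a i)) (blinfun_apply (a i) h)" for i h
  have "summable (\<lambda>i. f i h)" for h
    unfolding summable_Cauchy
  proof (intro allI impI)
    fix e :: real
    assume e: "e > 0"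
    have sm: "summable (\<lambda>i. (norm (blinfun_apply (a i) h))\<^sup>2)"
      by (rule bounded_imp_summable[where B="(C * norm h)\<^sup>2"])
        (auto intro!: column_bounded_finite[OF a])
    have "(e / (C + 1))\<^sup>2 > 0"
      using C e by simp
    then obtain N where N: "\<And>m n. m \<ge> N \<Longrightarrow>
        norm (\<Sum>i=m..<n. (norm (blinfun_apply (a i) h))\<^sup>2) < (e / (C + 1))\<^sup>2"
      using sm unfolding summable_Cauchy by meson
    have "norm (\<Sum>i=m..<n. f i h) < e" if "m \<ge> N" for m n
    proof -
      have "norm (\<Sum>i=m..<n. f i h) \<le> C * sqrt (\<Sum>i=m..<n. (norm (blinfun_apply (a i) h))\<^sup>2)"
        unfolding f_def by (rule row_vector_bound[OF a C]) simp
      also have "\<dots> \<le> C * (e / (C + 1))"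
      proof (intro mult_left_mono C real_le_lsqrt)
        show "(\<Sum>i=m..<n. (norm (blinfun_apply (a i) h))\<^sup>2) \<le> (e / (C + 1))\<^sup>2"
          using N[OF that, of n] by (simp add: abs_less_iff)
      qed (use e C in auto)
      also have "\<dots> < e"
        using e C by (simp add: field_simps)
      finally show ?thesis .
    qed
    then show "\<exists>N. \<forall>m\<ge>N. \<forall>n. norm (\<Sum>i=m..<n. f i h) < e"
      by blast
  qed
  then have sums: "(\<lambda>i. f i h) sums (\<Sum>i. f i h)" for h
    by (simp add: summable_sums)
  have "bounded_linear (\<lambda>h. \<Sum>i. f i h)"
  proof (rule bounded_linear_intro)
    show "(\<Sum>i. f i (x + y)) = (\<Sum>i. f i x) + (\<Sum>i. f i y)" for x y
      using sums_add[OF sums[of x] sums[of y]] by (simp add: f_def blinfun.add_right sums_iff)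
    show "(\<Sum>i. f i (r *\<^sub>R x)) = r *\<^sub>R (\<Sum>i. f i x)" for r x
      using sums_scaleR_right[OF sums[of x], of r] by (simp add: f_def blinfun.scaleR_right sums_iff)
    show "norm (\<Sum>i. f i h) \<le> norm h * C\<^sup>2" for h
    proof (rule Lim_bounded)
      show "(\<lambda>n. norm (\<Sum>i<n. f i h)) \<longlonglongrightarrow> norm (\<Sum>i. f i h)"
        using sums[of h] unfolding sums_def by (rule tendsto_norm)
      show "\<forall>n\<ge>0. norm (\<Sum>i<n. f i h) \<le> norm h * C\<^sup>2"
      proof (intro allI impI)
        fix n
        have "norm (\<Sum>i<n. f i h) \<le> norm (\<Sum>i<n. adj (a i) o\<^sub>L a i) * norm h"
          using norm_blinfun[of "\<Sum>i<n. adj (a i) o\<^sub>L a i" h] by (simp add: f_def blinfun.sum_left)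
        also have "\<dots> \<le> C\<^sup>2 * norm h"
          by (intro mult_right_mono norm_sum_adj_compose_le[OF a C]) auto
        finally show "norm (\<Sum>i<n. f i h) \<le> norm h * C\<^sup>2"
          by (simp add: mult.commute)
      qed
    qed
  qed
  then obtain T where T: "\<And>h. blinfun_apply T h = (\<Sum>i. f i h)"
    by (metis bounded_linear_Blinfun_apply)
  have sums_T: "(\<lambda>i. blinfun_apply (adj (a i) o\<^sub>L a i) h) sums blinfun_apply T h" for h
    using sums[of h] by (simp add: T f_def)
  have T_BH: "T \<in> BH"
    unfolding BH_def
  proof (safe)
    fix c h
    have "(\<lambda>i. c *\<^sub>C f i h) sums (c *\<^sub>C blinfun_apply T h)"
      using bounded_linear.sums[OF bounded_linear_scaleC sums] by (simp add: T)
    moreover have "c *\<^sub>C f i h = f i (c *\<^sub>C h)" for i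
      by (simp add: f_def BH_scaleC[OF BH] BH_scaleC[OF adj_BH[OF BH]])
    ultimately show "blinfun_apply T (c *\<^sub>C h) = c *\<^sub>C blinfun_apply T h"
      using sums[of "c *\<^sub>C h"] by (simp add: T sums_iff)
  qed
  have "adj T = T"
  proof (rule adj_eqI[OF T_BH])
    fix x y
    have "(\<lambda>i. f i x \<bullet> y) sums (blinfun_apply T x \<bullet> y)"
      using bounded_linear.sums[OF bounded_linear_inner_left sums] by (simp add: T)
    moreover have "(\<lambda>i. x \<bullet> f i y) sums (x \<bullet> blinfun_apply T y)"
      using bounded_linear.sums[OF bounded_linear_inner_right sums] by (simp add: T)
    moreover have "f i x \<bullet> y = x \<bullet> f i y" for i
      by (simp add: f_def inner_adj'[OF BH] inner_adj[OF BH])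
    ultimately show "blinfun_apply T x \<bullet> y = x \<bullet> blinfun_apply T y"
      by (simp add: sums_iff)
  qed
  then show thesis
    using that T_BH sums_T by blast
qed

section \<open>Approximate units\<close>

text \<open>For a self-adjoint operator \<open>0 \<le> c \<le> 1\<close> the numbers \<open>m k = x \<bullet> c\<^sup>k x\<close> are moments of a
  positive measure on \<open>[0, 1]\<close>: they are nonnegative, decreasing and convex. Hence the differences
  \<open>m k - m (k + 1)\<close> decrease and have sum at most \<open>m 0\<close>.\<close>

lemma moment_difference_bound:
  fixes c :: "'h::chilbert_space op"
  assumes sa: "\<And>x y. blinfun_apply c x \<bullet> y = x \<bullet> blinfun_apply c y"
    and ge0: "\<And>x. 0 \<le> x \<bullet> blinfun_apply c x"
    and le1: "\<And>x. x \<bullet> blinfun_apply c x \<le> x \<bullet> x"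
  defines "p k x \<equiv> (blinfun_apply c ^^ k) x"
  shows "real (2 * n + 1) * (p n x \<bullet> p n x - p n x \<bullet> blinfun_apply c (p n x)) \<le> (norm x)\<^sup>2"
    and "norm (p n x) \<le> norm x"
proof -
  have p_Suc: "p (Suc k) y = blinfun_apply c (p k y)" for k y
    by (simp add: p_def)
  have shift: "p i x \<bullet> p (j + k) x = p (i + k) x \<bullet> p j x" for i j k
  proof (induction k arbitrary: i j)
    case (Suc k)
    have "p i x \<bullet> p (j + Suc k) x = p (Suc i) x \<bullet> p (j + k) x"
      by (simp add: p_Suc sa)
    then show ?case
      using Suc.IH[of "Suc i" j] by simp
  qed simp
  define m where "m k = p 0 x \<bullet> p k x" for k
  have m_add: "p i x \<bullet> p j x = m (i + j)" for i j
    using shift[of 0 j i] by (simp add: m_def inner_commute add.commute)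
  define d where "d k = m k - m (Suc k)" for k
  \<comment> \<open>even moments are squares \<open>p i x \<bullet> p i x\<close>, odd ones are values \<open>p i x \<bullet> c (p i x)\<close>
    of the quadratic form of \<open>c\<close>\<close>
  have parity: thesis
    if "\<And>i. k = i + i \<Longrightarrow> thesis" "\<And>i. k = i + Suc i \<Longrightarrow> thesis" for k thesis
  proof (cases "even k")
    case True
    then obtain i where "k = 2 * i"
      by blast
    then show ?thesis
      using that(1)[of i] by simp
  next
    case False
    then obtain i where "k = 2 * i + 1"
      using oddE by blast
    then show ?thesis
      using that(2)[of i] by simp
  qed
  have m_ge0: "0 \<le> m k" for k
  proof (rule parity[of k])
    fix i
    assume "k = i + i"
    then show ?thesis
      using m_add[of i i] by (metis inner_ge_zero)
  next
    fix i
    assume "k = i + Suc i"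
    then show ?thesis
      using m_add[of i "Suc i"] ge0[of "p i x"] by (simp add: p_Suc)
  qed
  have d_decreasing: "d (Suc k) \<le> d k" for k
  proof (rule parity[of k])
    fix i
    assume k: "k = i + i"
    have "0 \<le> (p i x - p (Suc i) x) \<bullet> (p i x - p (Suc i) x)"
      by simp
    also have "\<dots> = d k - d (Suc k)"
      by (simp add: inner_diff m_add d_def k)
    finally show ?thesis
      by simp
  next
    fix i
    assume k: "k = i + Suc i"
    let ?y = "p i x - p (Suc i) x"
    have "blinfun_apply c ?y = p (Suc i) x - p (Suc (Suc i)) x"
      by (simp add: p_Suc blinfun.diff_right)
    then have "?y \<bullet> blinfun_apply c ?y = d k - d (Suc k)"
      by (simp add: inner_diff m_add d_def k)
    then show ?thesis
      using ge0[of ?y] by simp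
  qed
  have d_antimono: "d l \<le> d k" if "k \<le> l" for k l
    using lift_Suc_antimono_le[of d, OF d_decreasing that] .
  have telescope: "(\<Sum>k<N. d k) = m 0 - m N" for N
    unfolding d_def by (simp add: sum_lessThan_telescope')
  have m0: "m 0 = (norm x)\<^sup>2"
    by (simp add: m_def p_def power2_norm_eq_inner)
  have mean: "real N * d n' \<le> (norm x)\<^sup>2" if "N \<le> Suc n'" for N n'
  proof -
    have "real N * d n' = (\<Sum>k<N. d n')"
      by simp
    also have "\<dots> \<le> (\<Sum>k<N. d k)"
      by (intro sum_mono d_antimono) (use that in auto)
    also have "\<dots> \<le> (norm x)\<^sup>2"
      using telescope[of N] m_ge0[of N] m0 by simp
    finally show ?thesis .
  qed
  show "real (2 * n + 1) * (p n x \<bullet> p n x - p n x \<bullet> blinfun_apply c (p n x)) \<le> (norm x)\<^sup>2"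
  proof -
    have "p n x \<bullet> p n x - p n x \<bullet> blinfun_apply c (p n x) = d (2 * n)"
      unfolding p_Suc[symmetric] m_add d_def by (simp add: mult_2)
    then show ?thesis
      using mean[of "2 * n + 1" "2 * n"] by (simp only:)
  qed
  have d_ge0: "0 \<le> d k" for k
  proof -
    have "0 \<le> d (k + k)"
      using le1[of "p k x"] by (simp add: p_Suc[symmetric] m_add d_def)
    also have "\<dots> \<le> d k"
      by (rule d_antimono) simp
    finally show ?thesis .
  qed
  have "0 \<le> m 0 - m (n + n)"
    unfolding telescope[symmetric] by (intro sum_nonneg d_ge0)
  then have "(norm (p n x))\<^sup>2 \<le> (norm x)\<^sup>2"
    using m_add[of n n] m0 by (simp add: power2_norm_eq_inner)
  then show "norm (p n x) \<le> norm x"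
    by (rule power2_le_imp_le) simp
qed

context represented_cstar_algebra
begin

lemma mem_BH: "a \<in> A \<Longrightarrow> a \<in> BH"
  using subset_BH by blast

lemma scaleR_mem: "a \<in> A \<Longrightarrow> r *\<^sub>R a \<in> A"
  by (simp add: scaleR_blinfun_scaleC scaleC_mem)

lemma minus_mem: "a \<in> A \<Longrightarrow> b \<in> A \<Longrightarrow> a - b \<in> A"
  using add_mem[of a "(-1) *\<^sub>R b"] scaleR_mem[of b "-1"] by simp

lemma sum_mem: "(\<And>i. i \<in> I \<Longrightarrow> f i \<in> A) \<Longrightarrow> sum f I \<in> A"
  by (induction I rule: infinite_finite_induct) (auto intro: add_mem zero_mem)

lemma sums_mem: "f sums s \<Longrightarrow> (\<And>i. f i \<in> A) \<Longrightarrow> s \<in> A"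
  unfolding sums_def by (rule closed_sequentially[OF norm_closed]) (auto intro: sum_mem)

text \<open>Here \<open>u = 1 - (1 - b)\<^sup>n\<close> where \<open>b\<close> is a small multiple of \<open>\<Sum>\<^sub>s s s\<^sup>*\<close>: this is a polynomial
  in \<open>b\<close> without constant term, and \<open>s\<^sup>* (1 - b)\<^sup>n\<close> is small because \<open>b (1 - b)\<^sup>2\<^sup>n\<close> is. The
  norm of \<open>u\<close> is at most \<open>2\<close> because \<open>1 - u\<close> is a contraction.\<close>

lemma approximate_unit_finite:
  assumes S: "finite S" "S \<subseteq> A" and e: "e > 0"
  shows "\<exists>u\<in>A. norm u \<le> 2 \<and> (\<forall>a\<in>S. norm ((u o\<^sub>L a) - a) < e)"
proof -
  define b0 where "b0 = (\<Sum>s\<in>S. s o\<^sub>L adj s)"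
  have S_BH: "s \<in> BH" if "s \<in> S" for s
    using that S(2) mem_BH by blast
  have b0_A: "b0 \<in> A"
    unfolding b0_def by (intro sum_mem mult_mem adj_mem) (use S in auto)
  define \<delta> where "\<delta> = 1 / (norm b0 + 1)"
  have \<delta>: "\<delta> > 0"
    by (simp add: \<delta>_def add_nonneg_pos)
  define b where "b = \<delta> *\<^sub>R b0"
  have b_A: "b \<in> A"
    by (simp add: b_def b0_A scaleR_mem)
  define c where "c = id_blinfun - b"
  have c_apply: "blinfun_apply c x = x - blinfun_apply b x" for x
    by (simp add: c_def blinfun.diff_left)
  have inner_b0: "x \<bullet> blinfun_apply b0 x = (\<Sum>s\<in>S. (norm (blinfun_apply (adj s) x))\<^sup>2)" for x
    by (simp add: b0_def blinfun.sum_left inner_sum_right power2_norm_eq_inner inner_adj'[OF S_BH])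
  have inner_b: "x \<bullet> blinfun_apply b x = \<delta> * (x \<bullet> blinfun_apply b0 x)" for x
    by (simp add: b_def scaleR_blinfun.rep_eq)
  have b_ge0: "0 \<le> x \<bullet> blinfun_apply b x" for x
    unfolding inner_b inner_b0 using \<delta> by (intro mult_nonneg_nonneg sum_nonneg) auto
  have b_le1: "x \<bullet> blinfun_apply b x \<le> x \<bullet> x" for x
  proof -
    have "x \<bullet> blinfun_apply b0 x \<le> norm x * (norm b0 * norm x)"
      by (intro order_trans[OF norm_cauchy_schwarz] mult_left_mono norm_blinfun norm_ge_zero)
    also have "\<dots> \<le> (norm b0 + 1) * (norm x)\<^sup>2"
      by (simp add: power2_eq_square algebra_simps)
    finally have "x \<bullet> blinfun_apply b0 x / (norm b0 + 1) \<le> (norm x)\<^sup>2"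
      by (subst pos_divide_le_eq) (simp_all add: add_nonneg_pos mult.commute)
    then have "\<delta> * (x \<bullet> blinfun_apply b0 x) \<le> (norm x)\<^sup>2"
      by (simp add: \<delta>_def)
    then show ?thesis
      by (simp add: inner_b power2_norm_eq_inner)
  qed
  have b0_sa: "blinfun_apply b0 x \<bullet> y = x \<bullet> blinfun_apply b0 y" for x y
    by (simp add: b0_def blinfun.sum_left inner_sum_right inner_sum_left
        inner_adj[OF S_BH] inner_adj'[OF S_BH])
  have c_sa: "blinfun_apply c x \<bullet> y = x \<bullet> blinfun_apply c y" for x y
    by (simp add: c_apply inner_diff b_def scaleR_blinfun.rep_eq b0_sa)
  have c_ge0: "0 \<le> x \<bullet> blinfun_apply c x" for x
    using b_le1[of x] by (simp add: c_apply inner_diff)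
  have c_le1: "x \<bullet> blinfun_apply c x \<le> x \<bullet> x" for x
    using b_ge0[of x] by (simp add: c_apply inner_diff)
  note moments = moment_difference_bound[of c, OF c_sa c_ge0 c_le1]
  obtain n :: nat where n: "1 / (\<delta> * e\<^sup>2) < real n"
    using reals_Archimedean2 by blast
  have n': "1 / (\<delta> * real (2 * n + 1)) < e\<^sup>2"
  proof -
    define N where "N = real (2 * n + 1)"
    have "1 / (\<delta> * e\<^sup>2) < N" "N > 0"
      using n by (simp_all add: N_def)
    then have "1 / (\<delta> * N) < e\<^sup>2"
      using \<delta> e by (simp add: field_simps)
    then show ?thesis
      by (simp only: N_def)
  qed
  \<comment> \<open>if \<open>1 - u = c\<^sup>k\<close>, then \<open>1 - (b + u - b u) = (1 - b) (1 - u) = c\<^sup>k\<^sup>+\<^sup>1\<close>\<close>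
  have "\<exists>u\<in>A. \<forall>x. x - blinfun_apply u x = (blinfun_apply c ^^ k) x" for k
  proof (induction k)
    case 0
    show ?case
      by (rule bexI[of _ 0]) (auto simp: zero_mem)
  next
    case (Suc k)
    then obtain u where u: "u \<in> A" "\<And>x. x - blinfun_apply u x = (blinfun_apply c ^^ k) x"
      by blast
    have "x - blinfun_apply (b + u - (b o\<^sub>L u)) x = (blinfun_apply c ^^ Suc k) x" for x
      by (simp add: u(2)[symmetric] c_apply blinfun.add_left blinfun.diff_left blinfun.diff_right)
    moreover have "b + u - (b o\<^sub>L u) \<in> A"
      by (intro minus_mem add_mem mult_mem b_A u)
    ultimately show ?case
      by blast
  qed
  then obtain u where u: "u \<in> A" "\<And>x. x - blinfun_apply u x = (blinfun_apply c ^^ n) x"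
    by blast
  define w where "w = id_blinfun - u"
  have w_apply: "blinfun_apply w x = (blinfun_apply c ^^ n) x" for x
    by (simp add: w_def blinfun.diff_left u(2))
  have w_BH: "w \<in> BH"
    using mem_BH[OF u(1)] by (simp add: BH_def w_def blinfun.diff_left
        linear_diff[OF bounded_linear.linear, OF bounded_linear_scaleC])
  have "(blinfun_apply c ^^ k) x \<bullet> y = x \<bullet> (blinfun_apply c ^^ k) y" for k x y
    by (induction k arbitrary: y) (simp_all add: c_sa funpow_swap1[symmetric])
  then have adj_w: "adj w = w"
    by (intro adj_eqI w_BH) (simp add: w_apply)
  have norm_w: "norm w \<le> 1"
    by (rule norm_blinfun_bound) (auto simp: w_apply moments(2))
  have "norm u \<le> 2"
  proof -
    have "u = id_blinfun - w"
      by (simp add: w_def)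
    then have "norm u \<le> norm (id_blinfun :: 'h op) + norm w"
      by (metis norm_triangle_ineq4)
    also have "norm (id_blinfun :: 'h op) \<le> 1"
      by (rule norm_blinfun_id_le)
    finally show ?thesis
      using norm_w by simp
  qed
  moreover have "norm ((u o\<^sub>L a) - a) < e" if a: "a \<in> S" for a
  proof -
    define r where "r = sqrt (1 / (\<delta> * real (2 * n + 1)))"
    have r: "r < e"
      unfolding r_def using n' e by (intro real_less_lsqrt) auto
    have r0: "0 \<le> r"
      using \<delta> by (simp add: r_def)
    have r2: "r\<^sup>2 = 1 / (\<delta> * real (2 * n + 1))"
      unfolding r_def using \<delta> by (intro real_sqrt_pow2) simp
    have "norm (adj a o\<^sub>L w) \<le> r"
    proof (rule norm_blinfun_bound)
      fix x
      let ?y = "blinfun_apply w x"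
      have "(norm (blinfun_apply (adj a) ?y))\<^sup>2 \<le> (\<Sum>s\<in>S. (norm (blinfun_apply (adj s) ?y))\<^sup>2)"
        by (rule member_le_sum) (use a S in auto)
      also have "\<dots> = (?y \<bullet> blinfun_apply b ?y) / \<delta>"
        using \<delta> by (simp add: inner_b0[symmetric] inner_b)
      also have "\<dots> = (?y \<bullet> ?y - ?y \<bullet> blinfun_apply c ?y) / \<delta>"
        by (simp add: c_apply inner_diff)
      also have "\<dots> \<le> ((norm x)\<^sup>2 / real (2 * n + 1)) / \<delta>"
        using moments(1)[of n x] \<delta>
        by (intro divide_right_mono) (simp_all add: w_apply pos_le_divide_eq mult.commute)
      also have "\<dots> = r\<^sup>2 * (norm x)\<^sup>2"
        using \<delta> by (simp only: r2) (simp add: mult.commute)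
      also have "\<dots> = (r * norm x)\<^sup>2"
        by (rule power_mult_distrib[symmetric])
      finally show "norm (blinfun_apply (adj a o\<^sub>L w) x) \<le> r * norm x"
        unfolding blinfun_apply_blinfun_compose by (rule power2_le_imp_le) (simp add: r0)
    qed (rule r0)
    also have "adj a o\<^sub>L w = adj (w o\<^sub>L a)"
      by (simp add: adj_compose adj_w w_BH S_BH a)
    also have "norm (adj (w o\<^sub>L a)) = norm (w o\<^sub>L a)"
      by (simp add: compose_BH w_BH S_BH a)
    also have "w o\<^sub>L a = a - (u o\<^sub>L a)"
      by (rule blinfun_eqI) (simp add: w_def blinfun.diff_left)
    finally show ?thesis
      using r by (simp add: norm_minus_commute)
  qed
  ultimately show ?thesis
    using u(1) by blast
qed

text \<open>By density, a property that defines a closed subspace need only be checked on the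
  vectors \<open>a h\<close>.\<close>

lemma nondegenerate_induct:
  assumes "closed V" "subspace V" "\<And>a h. a \<in> A \<Longrightarrow> blinfun_apply a h \<in> V"
  shows "x \<in> V"
proof -
  have "closure (span {blinfun_apply a h | a h. a \<in> A}) \<subseteq> V"
    by (intro closure_minimal span_minimal assms) (use assms(3) in auto)
  then show ?thesis
    using nondegenerate by auto
qed

lemma eq_if_compose_eq:
  assumes "\<And>a. a \<in> A \<Longrightarrow> S o\<^sub>L a = T o\<^sub>L a"
  shows "S = T"
proof (rule blinfun_eqI)
  fix x
  have "x \<in> {x. blinfun_apply (S - T) x = 0}"
  proof (rule nondegenerate_induct)
    show "closed {x. blinfun_apply (S - T) x = 0}"
      by (intro closed_Collect_eq continuous_intros)
    show "subspace {x. blinfun_apply (S - T) x = 0}"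
      by (auto simp: subspace_def blinfun.add_right blinfun.scaleR_right)
    show "blinfun_apply a h \<in> {x. blinfun_apply (S - T) x = 0}" if "a \<in> A" for a h
      using arg_cong[OF assms[OF that], of "\<lambda>R. blinfun_apply R h"] by (simp add: blinfun.diff_left)
  qed
  then show "blinfun_apply S x = blinfun_apply T x"
    by (simp add: blinfun.diff_left)
qed

text \<open>The approximate unit is encoded as a filter on operators, so that limits along it are
  ordinary limits.\<close>

definition approx_unit :: "'h op filter"
  where "approx_unit = (INF (S, e) \<in> {S. finite S \<and> S \<subseteq> A} \<times> {0<..}.
    principal {u \<in> A. norm u \<le> 2 \<and> (\<forall>a\<in>S. norm ((u o\<^sub>L a) - a) < e)})"

lemma eventually_approx_unit:
  "eventually P approx_unit \<longleftrightarrow> (\<exists>S e. finite S \<and> S \<subseteq> A \<and> e > 0 \<and>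
    (\<forall>u\<in>A. norm u \<le> 2 \<longrightarrow> (\<forall>a\<in>S. norm ((u o\<^sub>L a) - a) < e) \<longrightarrow> P u))"
proof -
  let ?B = "{S. finite S \<and> S \<subseteq> A} \<times> {0::real<..}"
  let ?U = "\<lambda>S e. {u \<in> A. norm u \<le> 2 \<and> (\<forall>a\<in>S. norm ((u o\<^sub>L a) - a) < e)}"
  have "eventually P approx_unit \<longleftrightarrow>
      (\<exists>p\<in>?B. eventually P (case p of (S, e) \<Rightarrow> principal (?U S e)))"
    unfolding approx_unit_def
  proof (rule eventually_INF_base)
    show "?B \<noteq> {}"
      by (auto intro!: exI[of _ "{}"] exI[of _ "1::real"])
    fix p q
    assume pq: "p \<in> ?B" "q \<in> ?B"
    show "\<exists>r\<in>?B. (case r of (S, e) \<Rightarrow> principal (?U S e))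
        \<le> inf (case p of (S, e) \<Rightarrow> principal (?U S e)) (case q of (S, e) \<Rightarrow> principal (?U S e))"
      using pq by (intro bexI[of _ "(fst p \<union> fst q, min (snd p) (snd q))"]) auto
  qed
  then show ?thesis
    by (simp add: eventually_principal Bex_def split_paired_Ex Ball_def imp_conjL conj_assoc)
qed

lemma approx_unit_not_bot: "approx_unit \<noteq> bot"
proof
  assume "approx_unit = bot"
  then have "eventually (\<lambda>u. False) approx_unit"
    by simp
  then show False
    unfolding eventually_approx_unit using approximate_unit_finite by meson
qed

lemma eventually_approx_unit_mem: "\<forall>\<^sub>F u in approx_unit. u \<in> A \<and> norm u \<le> 2"
  unfolding eventually_approx_unit by (rule exI[of _ "{}"]) (auto intro: exI[of _ "1::real"])

lemma tendsto_approx_unit_compose: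
  assumes "a \<in> A"
  shows "((\<lambda>u. u o\<^sub>L a) \<longlongrightarrow> a) approx_unit"
proof (rule tendstoI)
  fix e :: real
  assume "e > 0"
  then show "\<forall>\<^sub>F u in approx_unit. dist (u o\<^sub>L a) a < e"
    unfolding eventually_approx_unit using assms
    by (intro exI[of _ "{a}"] exI[of _ e]) (auto simp: dist_norm)
qed

text \<open>A uniformly bounded family of operators along a filter that converges on all vectors \<open>a h\<close>
  converges strongly, since the set of vectors on which it converges is a closed subspace.\<close>

lemma strong_limit_exists:
  fixes \<Phi> :: "'b \<Rightarrow> 'h op"
  assumes F: "F \<noteq> bot" and bound: "\<forall>\<^sub>F u in F. norm (\<Phi> u) \<le> C" and BH: "\<forall>\<^sub>F u in F. \<Phi> u \<in> BH"
    and conv: "\<And>a h. a \<in> A \<Longrightarrow> \<exists>y. ((\<lambda>u. blinfun_apply (\<Phi> u) (blinfun_apply a h)) \<longlongrightarrow> y) F"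
  obtains T where "T \<in> BH" "norm T \<le> C" "\<And>x. ((\<lambda>u. blinfun_apply (\<Phi> u) x) \<longlongrightarrow> blinfun_apply T x) F"
proof -
  define V where "V = {x. \<exists>y. ((\<lambda>u. blinfun_apply (\<Phi> u) x) \<longlongrightarrow> y) F}"
  have C: "C \<ge> 0"
    using eventually_happens'[OF F bound] norm_ge_zero order_trans by blast
  have le: "norm y \<le> C * norm x" if "((\<lambda>u. blinfun_apply (\<Phi> u) x) \<longlongrightarrow> y) F" for x y
  proof (rule tendsto_upperbound[OF tendsto_norm[OF that]])
    show "\<forall>\<^sub>F u in F. norm (blinfun_apply (\<Phi> u) x) \<le> C * norm x"
      using bound
    proof eventually_elim
      case (elim u)
      have "norm (blinfun_apply (\<Phi> u) x) \<le> norm (\<Phi> u) * norm x"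
        by (rule norm_blinfun)
      also have "\<dots> \<le> C * norm x"
        by (intro mult_right_mono elim) simp
      finally show ?case .
    qed
  qed (rule F)
  have "subspace V"
    unfolding subspace_def
  proof (intro conjI ballI allI)
    show "0 \<in> V"
      by (auto simp: V_def intro!: exI[of _ 0])
    show "x + y \<in> V" if xy: "x \<in> V" "y \<in> V" for x y
    proof -
      obtain x' y' where "((\<lambda>u. blinfun_apply (\<Phi> u) x) \<longlongrightarrow> x') F" "((\<lambda>u. blinfun_apply (\<Phi> u) y) \<longlongrightarrow> y') F"
        using xy by (auto simp: V_def)
      then have "((\<lambda>u. blinfun_apply (\<Phi> u) (x + y)) \<longlongrightarrow> x' + y') F"
        by (simp add: blinfun.add_right tendsto_add)
      then show ?thesis
        by (auto simp: V_def)
    qed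
    show "r *\<^sub>R x \<in> V" if x: "x \<in> V" for r x
    proof -
      obtain x' where "((\<lambda>u. blinfun_apply (\<Phi> u) x) \<longlongrightarrow> x') F"
        using x by (auto simp: V_def)
      then have "((\<lambda>u. blinfun_apply (\<Phi> u) (r *\<^sub>R x)) \<longlongrightarrow> r *\<^sub>R x') F"
        by (simp add: blinfun.scaleR_right tendsto_scaleR)
      then show ?thesis
        by (auto simp: V_def)
    qed
  qed
  moreover have "closed V"
    unfolding closed_sequential_limits
  proof (intro allI impI, elim conjE)
    fix X x
    assume "\<forall>n. X n \<in> V" and X: "X \<longlonglongrightarrow> x"
    then obtain Y where Y: "\<And>n. ((\<lambda>u. blinfun_apply (\<Phi> u) (X n)) \<longlongrightarrow> Y n) F"
      unfolding V_def by (auto simp: choice_iff)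
    have Y_diff: "norm (Y m - Y n) \<le> C * norm (X m - X n)" for m n
      by (rule le) (simp add: blinfun.diff_right tendsto_diff Y)
    have "Cauchy Y"
    proof (rule metric_CauchyI)
      fix e :: real
      assume e: "e > 0"
      then have "e / (C + 1) > 0"
        using C by simp
      then obtain N where N: "\<And>m n. m \<ge> N \<Longrightarrow> n \<ge> N \<Longrightarrow> norm (X m - X n) < e / (C + 1)"
        using LIMSEQ_imp_Cauchy[OF X] unfolding Cauchy_def dist_norm by meson
      have "dist (Y m) (Y n) < e" if "m \<ge> N" "n \<ge> N" for m n
      proof -
        have "dist (Y m) (Y n) \<le> C * (e / (C + 1))"
          unfolding dist_norm using N[OF that]
          by (intro order_trans[OF Y_diff] mult_left_mono C) simp
        also have "\<dots> < e"
          using e C by (simp add: field_simps)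
        finally show ?thesis .
      qed
      then show "\<exists>N. \<forall>m\<ge>N. \<forall>n\<ge>N. dist (Y m) (Y n) < e"
        by blast
    qed
    then obtain y where y: "Y \<longlonglongrightarrow> y"
      using Cauchy_convergent convergent_def by blast
    have "((\<lambda>u. blinfun_apply (\<Phi> u) x) \<longlongrightarrow> y) F"
    proof (rule tendstoI)
      fix e :: real
      assume e: "e > 0"
      have "\<forall>\<^sub>F n in sequentially. dist (Y n) y < e / 3"
        using tendstoD[OF y, of "e / 3"] e by simp
      moreover have "\<forall>\<^sub>F n in sequentially. dist (X n) x < e / (3 * (C + 1))"
        using tendstoD[OF X, of "e / (3 * (C + 1))"] e C by simp
      ultimately have "\<forall>\<^sub>F n in sequentially. dist (Y n) y < e / 3 \<and> dist (X n) x < e / (3 * (C + 1))"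
        by (rule eventually_conj)
      then obtain n where n: "dist (Y n) y < e / 3" "dist (X n) x < e / (3 * (C + 1))"
        using eventually_happens'[OF sequentially_bot] by blast
      have "\<forall>\<^sub>F u in F. dist (blinfun_apply (\<Phi> u) (X n)) (Y n) < e / 3"
        using tendstoD[OF Y[of n], of "e / 3"] e by simp
      with bound show "\<forall>\<^sub>F u in F. dist (blinfun_apply (\<Phi> u) x) y < e"
      proof eventually_elim
        case (elim u)
        have "dist (blinfun_apply (\<Phi> u) x) (blinfun_apply (\<Phi> u) (X n)) \<le> norm (\<Phi> u) * norm (x - X n)"
          by (simp add: dist_norm blinfun.diff_right[symmetric] norm_blinfun)
        also have "\<dots> \<le> C * (e / (3 * (C + 1)))"
          using n(2) C elim(1) by (intro mult_mono) (auto simp: dist_norm norm_minus_commute)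
        also have "\<dots> < e / 3"
          using e C by (simp add: field_simps)
        finally have "dist (blinfun_apply (\<Phi> u) x) (blinfun_apply (\<Phi> u) (X n)) < e / 3" .
        moreover have "dist (blinfun_apply (\<Phi> u) x) y \<le>
            dist (blinfun_apply (\<Phi> u) x) (blinfun_apply (\<Phi> u) (X n)) +
            dist (blinfun_apply (\<Phi> u) (X n)) (Y n) + dist (Y n) y"
          using dist_triangle[of "blinfun_apply (\<Phi> u) x" y "blinfun_apply (\<Phi> u) (X n)"]
            dist_triangle[of "blinfun_apply (\<Phi> u) (X n)" y "Y n"] by simp
        ultimately show ?case
          using elim(2) n(1) by simp
      qed
    qed
    then show "x \<in> V"
      by (auto simp: V_def)
  qed
  moreover have "blinfun_apply a h \<in> V" if "a \<in> A" for a h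
    unfolding V_def using conv[OF that] by blast
  ultimately have "x \<in> V" for x
    by (intro nondegenerate_induct[of V x])
  then have "\<exists>y. ((\<lambda>u. blinfun_apply (\<Phi> u) x) \<longlongrightarrow> y) F" for x
    by (simp add: V_def)
  then obtain t where t: "\<And>x. ((\<lambda>u. blinfun_apply (\<Phi> u) x) \<longlongrightarrow> t x) F"
    by metis
  have "bounded_linear t"
  proof (rule bounded_linear_intro)
    show "t (x + y) = t x + t y" for x y
      using tendsto_add[OF t[of x] t[of y]] t[of "x + y"]
      by (intro tendsto_unique[OF F]) (simp_all add: blinfun.add_right)
    show "t (r *\<^sub>R x) = r *\<^sub>R t x" for r x
      using tendsto_scaleR[OF tendsto_const t[of x], of r] t[of "r *\<^sub>R x"]
      by (intro tendsto_unique[OF F]) (simp_all add: blinfun.scaleR_right)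
    show "norm (t x) \<le> norm x * C" for x
      using le[OF t] by (simp add: mult.commute)
  qed
  then obtain T where T: "\<And>x. blinfun_apply T x = t x"
    by (metis bounded_linear_Blinfun_apply)
  have "blinfun_apply T (c *\<^sub>C x) = c *\<^sub>C blinfun_apply T x" for c x
  proof (rule tendsto_unique[OF F])
    show "((\<lambda>u. blinfun_apply (\<Phi> u) (c *\<^sub>C x)) \<longlongrightarrow> blinfun_apply T (c *\<^sub>C x)) F"
      by (simp add: T t)
    have "\<forall>\<^sub>F u in F. c *\<^sub>C blinfun_apply (\<Phi> u) x = blinfun_apply (\<Phi> u) (c *\<^sub>C x)"
      using BH by eventually_elim (simp add: BH_scaleC)
    then show "((\<lambda>u. blinfun_apply (\<Phi> u) (c *\<^sub>C x)) \<longlongrightarrow> c *\<^sub>C blinfun_apply T x) F"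
      by (rule Lim_transform_eventually[OF tendsto_scaleC[OF t[folded T]]])
  qed
  then have "T \<in> BH"
    by (simp add: BH_def)
  moreover have "norm T \<le> C"
    by (rule norm_blinfun_bound) (simp_all add: C T le[OF t])
  ultimately show thesis
    using that t by (simp add: T)
qed

lemma tendsto_approx_unit: "((\<lambda>u. blinfun_apply u x) \<longlongrightarrow> x) approx_unit"
proof -
  have conv: "((\<lambda>u. blinfun_apply u (blinfun_apply a h)) \<longlongrightarrow> blinfun_apply a h) approx_unit"
    if "a \<in> A" for a h
    using blinfun.tendsto[OF tendsto_approx_unit_compose[OF that] tendsto_const, of h] by simp
  obtain T where T: "\<And>x. ((\<lambda>u. blinfun_apply u x) \<longlongrightarrow> blinfun_apply T x) approx_unit"
  proof (rule strong_limit_exists[of approx_unit "\<lambda>u. u" 2])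
    show "\<forall>\<^sub>F u in approx_unit. norm u \<le> 2" "\<forall>\<^sub>F u in approx_unit. u \<in> BH"
      using eventually_approx_unit_mem by (eventually_elim, simp add: mem_BH)+
  qed (use conv approx_unit_not_bot in blast)+
  have "T o\<^sub>L a = id_blinfun o\<^sub>L a" if "a \<in> A" for a
    using tendsto_unique[OF approx_unit_not_bot T conv[OF that]] by (intro blinfun_eqI) simp
  then have "T = id_blinfun"
    by (rule eq_if_compose_eq)
  then show ?thesis
    using T[of x] by simp
qed

end

section \<open>Multipliers and adjointable maps of the algebra\<close>

lemma alg_module_simps [simp]:
  "carr (alg_module A) = A"
  "act (alg_module A) x a = x o\<^sub>L a"
  "ip (alg_module A) x y = adj x o\<^sub>L y"
  by (simp_all add: alg_module_def)

lemma bounded_hom_nonneg_bound: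
  assumes "bounded_hom A M N F"
  obtains K where "K \<ge> 0" "\<And>x. x \<in> carr M \<Longrightarrow> mnorm N (F x) \<le> K * mnorm M x"
proof -
  obtain K where K: "\<And>x. x \<in> carr M \<Longrightarrow> mnorm N (F x) \<le> K * mnorm M x"
    using assms unfolding bounded_hom_def by blast
  have "mnorm N (F x) \<le> \<bar>K\<bar> * mnorm M x" if "x \<in> carr M" for x
  proof -
    have "K * mnorm M x \<le> \<bar>K\<bar> * mnorm M x"
      by (intro mult_right_mono) (simp_all add: mnorm_def)
    then show ?thesis
      using K[OF that] by simp
  qed
  then show thesis
    using that[of "\<bar>K\<bar>"] by simp
qed

lemma bounded_hom_diff:
  assumes "bounded_hom A M N F" "x \<in> carr M" "y \<in> carr M" "x - y \<in> carr M"
  shows "F (x - y) = F x - F y"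
proof -
  have "F ((x - y) + y) = F (x - y) + F y"
    using assms unfolding bounded_hom_def by blast
  then show ?thesis
    by (simp add: algebra_simps)
qed

lemma bounded_hom_compose:
  assumes F: "bounded_hom A M N F" and G: "bounded_hom A N P G"
  shows "bounded_hom A M P (G \<circ> F)"
proof -
  obtain K where K: "K \<ge> 0" "\<And>x. x \<in> carr M \<Longrightarrow> mnorm N (F x) \<le> K * mnorm M x"
    using bounded_hom_nonneg_bound[OF F] by blast
  obtain L where L: "L \<ge> 0" "\<And>x. x \<in> carr N \<Longrightarrow> mnorm P (G x) \<le> L * mnorm N x"
    using bounded_hom_nonneg_bound[OF G] by blast
  have "mnorm P (G (F x)) \<le> (L * K) * mnorm M x" if "x \<in> carr M" for x
  proof -
    have "F x \<in> carr N"
      using F that by (simp add: bounded_hom_def)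
    then have "mnorm P (G (F x)) \<le> L * mnorm N (F x)"
      by (rule L)
    also have "\<dots> \<le> L * (K * mnorm M x)"
      by (intro mult_left_mono L K that)
    finally show ?thesis
      by (simp add: mult.assoc)
  qed
  then show ?thesis
    using F G unfolding bounded_hom_def by auto
qed

context represented_cstar_algebra
begin

lemma mnorm_alg_module: "a \<in> A \<Longrightarrow> mnorm (alg_module A) a = norm a"
  by (simp add: mnorm_def norm_adj_compose_self mem_BH)

lemma RM_BH: "T \<in> RM A \<Longrightarrow> T \<in> BH" and LM_BH: "T \<in> LM A \<Longrightarrow> T \<in> BH"
  and Mult_BH: "T \<in> Mult A \<Longrightarrow> T \<in> BH"
  by (simp_all add: RM_def LM_def Mult_def)

lemma adj_LM: assumes "T \<in> LM A" shows "adj T \<in> RM A"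
  unfolding RM_def
proof (intro CollectI conjI ballI)
  show "adj T \<in> BH"
    using assms by (simp add: LM_BH adj_BH)
  fix a
  assume a: "a \<in> A"
  have "adj (T o\<^sub>L adj a) \<in> A"
    using assms a by (auto simp: LM_def intro!: adj_mem)
  then show "a o\<^sub>L adj T \<in> A"
    using assms a by (simp add: adj_compose LM_BH adj_BH mem_BH)
qed

lemma adj_RM: assumes "T \<in> RM A" shows "adj T \<in> LM A"
  unfolding LM_def
proof (intro CollectI conjI ballI)
  show "adj T \<in> BH"
    using assms by (simp add: RM_BH adj_BH)
  fix a
  assume a: "a \<in> A"
  have "adj (adj a o\<^sub>L T) \<in> A"
    using assms a by (auto simp: RM_def intro!: adj_mem)
  then show "adj T o\<^sub>L a \<in> A"
    using assms a by (simp add: adj_compose RM_BH adj_BH mem_BH)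
qed

lemma adj_Mult: "T \<in> Mult A \<Longrightarrow> adj T \<in> Mult A"
  by (simp add: Mult_def adj_LM adj_RM)

lemma id_Mult: "id_blinfun \<in> Mult A"
proof -
  have "id_blinfun o\<^sub>L a = a" "a o\<^sub>L id_blinfun = a" for a :: "'h op"
    by (rule blinfun_eqI, simp)+
  then show ?thesis
    by (simp add: Mult_def LM_def RM_def)
qed

lemma zero_Mult: "0 \<in> Mult A"
  by (simp add: Mult_def LM_def RM_def zero_mem)

text \<open>The left-hand version of cancellation follows by passing to adjoints, as \<open>A\<close> is self-adjoint.\<close>

lemma eq_if_compose_eq_left:
  assumes "S \<in> BH" "T \<in> BH" "\<And>a. a \<in> A \<Longrightarrow> a o\<^sub>L S = a o\<^sub>L T"
  shows "S = T"
proof -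
  have "adj S o\<^sub>L a = adj T o\<^sub>L a" if a: "a \<in> A" for a
    using arg_cong[OF assms(3)[OF adj_mem[OF a]], of adj] assms(1,2) a
    by (simp add: adj_compose adj_BH mem_BH)
  then have "adj S = adj T"
    by (rule eq_if_compose_eq)
  then show ?thesis
    using assms(1,2) by (metis adj_adj)
qed

text \<open>The multiplier of a bounded homomorphism \<open>\<phi>\<close> is the strong limit of \<open>\<phi> u\<close> along the approximate
  unit: on vectors \<open>a h\<close> the limit exists since \<open>\<phi> u a = \<phi> (u a)\<close>.\<close>

lemma left_multiplier_exists:
  assumes \<phi>: "bounded_hom A (alg_module A) (alg_module A) \<phi>"
  obtains T where "T \<in> LM A" "\<And>a. a \<in> A \<Longrightarrow> \<phi> a = T o\<^sub>L a"
proof -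
  obtain K where K: "K \<ge> 0" "\<And>a. a \<in> A \<Longrightarrow> mnorm (alg_module A) (\<phi> a) \<le> K * mnorm (alg_module A) a"
    using bounded_hom_nonneg_bound[OF \<phi>] by (metis alg_module_simps(1))
  have mem: "\<phi> a \<in> A" if "a \<in> A" for a
    using \<phi> that by (simp add: bounded_hom_def)
  have bound: "norm (\<phi> a) \<le> K * norm a" if "a \<in> A" for a
    using K(2)[OF that] that by (simp add: mnorm_alg_module mem)
  have mult: "\<phi> (a o\<^sub>L b) = \<phi> a o\<^sub>L b" if "a \<in> A" "b \<in> A" for a b
    using \<phi> that by (simp add: bounded_hom_def)
  have conv_op: "((\<lambda>u. \<phi> u o\<^sub>L a) \<longlongrightarrow> \<phi> a) approx_unit" if a: "a \<in> A" for a
  proof -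
    have "((\<lambda>u. (\<phi> u o\<^sub>L a) - \<phi> a) \<longlongrightarrow> 0) approx_unit"
    proof (rule Lim_null_comparison)
      have "((\<lambda>u. K * norm ((u o\<^sub>L a) - a)) \<longlongrightarrow> K * norm (a - a)) approx_unit"
        by (intro tendsto_intros tendsto_approx_unit_compose a)
      then show "((\<lambda>u. K * norm ((u o\<^sub>L a) - a)) \<longlongrightarrow> 0) approx_unit"
        by simp
      have "norm ((\<phi> u o\<^sub>L a) - \<phi> a) \<le> K * norm ((u o\<^sub>L a) - a)" if u: "u \<in> A" for u
      proof -
        have "(\<phi> u o\<^sub>L a) - \<phi> a = \<phi> ((u o\<^sub>L a) - a)"
          by (simp add: bounded_hom_diff[OF \<phi>] mult u a mult_mem minus_mem)
        then show ?thesis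
          using bound[of "(u o\<^sub>L a) - a"] by (simp add: u a mult_mem minus_mem)
      qed
      then show "\<forall>\<^sub>F u in approx_unit. norm ((\<phi> u o\<^sub>L a) - \<phi> a) \<le> K * norm ((u o\<^sub>L a) - a)"
        using eventually_approx_unit_mem by (rule eventually_mono[rotated]) blast
    qed
    then show ?thesis
      by (rule Lim_null[THEN iffD2])
  qed
  have conv: "((\<lambda>u. blinfun_apply (\<phi> u) (blinfun_apply a h)) \<longlongrightarrow> blinfun_apply (\<phi> a) h) approx_unit"
    if "a \<in> A" for a h
    using blinfun.tendsto[OF conv_op[OF that] tendsto_const, of h] by simp
  obtain T where T: "T \<in> BH"
    "\<And>x. ((\<lambda>u. blinfun_apply (\<phi> u) x) \<longlongrightarrow> blinfun_apply T x) approx_unit"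
  proof (rule strong_limit_exists[of approx_unit \<phi> "K * 2"])
    show "\<forall>\<^sub>F u in approx_unit. \<phi> u \<in> BH"
      using eventually_approx_unit_mem by eventually_elim (simp add: mem mem_BH)
    show "\<forall>\<^sub>F u in approx_unit. norm (\<phi> u) \<le> K * 2"
      using eventually_approx_unit_mem
    proof eventually_elim
      case (elim u)
      then have "norm (\<phi> u) \<le> K * norm u"
        by (simp add: bound)
      also have "\<dots> \<le> K * 2"
        using elim by (intro mult_left_mono K) simp
      finally show ?case .
    qed
  qed (use conv approx_unit_not_bot in blast)+
  have T_compose: "\<phi> a = T o\<^sub>L a" if "a \<in> A" for a
    using tendsto_unique[OF approx_unit_not_bot conv[OF that] T(2)] by (intro blinfun_eqI) simp
  moreover have "T \<in> LM A"
    using T(1) by (auto simp: LM_def T_compose[symmetric] mem)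
  ultimately show thesis
    using that by blast
qed

text \<open>Adjointability makes the adjoint of the representing left multiplier a left multiplier, too.\<close>

lemma adjointable_algebra_iff:
  "adjointable A (alg_module A) (alg_module A) f \<longleftrightarrow> (\<exists>T\<in>Mult A. \<forall>a\<in>A. f a = T o\<^sub>L a)"
proof
  assume f: "adjointable A (alg_module A) (alg_module A) f"
  then have hom: "bounded_hom A (alg_module A) (alg_module A) f"
    by (simp add: adjointable_def)
  obtain T where T: "T \<in> LM A" "\<And>a. a \<in> A \<Longrightarrow> f a = T o\<^sub>L a"
    using left_multiplier_exists[OF hom] by blast
  obtain G where G: "\<And>y. y \<in> A \<Longrightarrow> G y \<in> A"
    "\<And>x y. x \<in> A \<Longrightarrow> y \<in> A \<Longrightarrow> adj (f x) o\<^sub>L y = adj x o\<^sub>L G y"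
    using f by (auto simp: adjointable_def)
  have "adj T o\<^sub>L y = G y" if y: "y \<in> A" for y
  proof (rule eq_if_compose_eq_left)
    fix a
    assume a: "a \<in> A"
    have "a o\<^sub>L (adj T o\<^sub>L y) = adj (f (adj a)) o\<^sub>L y"
      using a T by (simp add: adj_mem adj_compose LM_BH mem_BH adj_BH compose_assoc)
    also have "\<dots> = a o\<^sub>L G y"
      using a y by (simp add: G(2) adj_mem mem_BH)
    finally show "a o\<^sub>L (adj T o\<^sub>L y) = a o\<^sub>L G y" .
  qed (use y T G in \<open>auto intro: compose_BH adj_BH mem_BH dest: LM_BH\<close>)
  then have "adj T \<in> LM A"
    using T G by (auto simp: LM_def intro: adj_BH)
  then have "adj (adj T) \<in> RM A"
    by (rule adj_LM)
  then have "T \<in> Mult A"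
    using T by (simp add: Mult_def LM_BH)
  then show "\<exists>T\<in>Mult A. \<forall>a\<in>A. f a = T o\<^sub>L a"
    using T by blast
next
  assume "\<exists>T\<in>Mult A. \<forall>a\<in>A. f a = T o\<^sub>L a"
  then obtain T where T: "T \<in> Mult A" "\<And>a. a \<in> A \<Longrightarrow> f a = T o\<^sub>L a"
    by blast
  have T_A: "T o\<^sub>L a \<in> A" "adj T o\<^sub>L a \<in> A" if "a \<in> A" for a
    using T(1) adj_Mult[OF T(1)] that by (auto simp: Mult_def LM_def)
  have "bounded_hom A (alg_module A) (alg_module A) f"
    unfolding bounded_hom_def alg_module_simps
  proof (intro conjI ballI allI)
    fix x y c
    assume x: "x \<in> A"
    show "f x \<in> A"
      using x by (simp add: T T_A)
    show "f (c *\<^sub>C x) = c *\<^sub>C f x"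
      using x by (intro blinfun_eqI) (simp add: T scaleC_mem BH_scaleC Mult_BH)
    assume y: "y \<in> A"
    show "f (x + y) = f x + f y"
      using x y by (simp add: T add_mem compose_add_right)
    show "f (x o\<^sub>L y) = f x o\<^sub>L y"
      using x y by (simp add: T mult_mem compose_assoc)
  next
    show "\<exists>K. \<forall>x\<in>A. mnorm (alg_module A) (f x) \<le> K * mnorm (alg_module A) x"
      by (rule exI[of _ "norm T"]) (auto simp: mnorm_alg_module T T_A norm_blinfun_compose)
  qed
  moreover have "adj (f x) o\<^sub>L y = adj x o\<^sub>L (adj T o\<^sub>L y)" if "x \<in> A" "y \<in> A" for x y
    using that T by (simp add: adj_compose Mult_BH mem_BH compose_assoc)
  ultimately show "adjointable A (alg_module A) (alg_module A) f"
    unfolding adjointable_def alg_module_simps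
    by (intro conjI exI[of _ "\<lambda>y. adj T o\<^sub>L y"]) (auto simp: T_A)
qed

end

section \<open>The standard module\<close>

lemma l2_simps [simp]:
  "act (l2 A) x a = (\<lambda>i. x i o\<^sub>L a)"
  "ip (l2 A) x y = (\<Sum>i. adj (x i) o\<^sub>L y i)"
  by (simp_all add: l2_def)

lemma carr_l2: "x \<in> carr (l2 A) \<longleftrightarrow> (\<forall>i. x i \<in> A) \<and> summable (\<lambda>i. adj (x i) o\<^sub>L x i)"
  by (simp add: l2_def)

lemma mnorm_l2: "mnorm (l2 A) x = sqrt (norm (\<Sum>i. adj (x i) o\<^sub>L x i))"
  by (simp add: mnorm_def)

definition single :: "nat \<Rightarrow> 'h::chilbert_space op \<Rightarrow> nat \<Rightarrow> 'h op"
  where "single k a = (\<lambda>i. if i = k then a else 0)"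

lemma single_apply [simp]: "single k a k = a" "i \<noteq> k \<Longrightarrow> single k a i = 0"
  by (simp_all add: single_def)

context represented_cstar_algebra
begin

lemma l2_mem: "x \<in> carr (l2 A) \<Longrightarrow> x i \<in> A"
  by (simp add: carr_l2)

lemma l2_summable: "x \<in> carr (l2 A) \<Longrightarrow> summable (\<lambda>i. adj (x i) o\<^sub>L x i)"
  by (simp add: carr_l2)

lemma l2_column_bounded: "x \<in> carr (l2 A) \<Longrightarrow> column_bounded (mnorm (l2 A) x) x"
  unfolding mnorm_l2 by (rule column_bounded_summable) (simp_all add: l2_mem mem_BH l2_summable)

lemma mnorm_l2_nonneg: "0 \<le> mnorm (l2 A) x"
  by (simp add: mnorm_l2)

lemma norm_coordinate_le:
  assumes "x \<in> carr (l2 A)"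
  shows "norm (x k) \<le> mnorm (l2 A) x"
proof (rule norm_blinfun_bound[OF mnorm_l2_nonneg])
  fix h
  have "(norm (blinfun_apply (x k) h))\<^sup>2 \<le> (mnorm (l2 A) x * norm h)\<^sup>2"
    using column_bounded_finite[OF l2_column_bounded[OF assms], of "{k}" h] by simp
  then show "norm (blinfun_apply (x k) h) \<le> mnorm (l2 A) x * norm h"
    by (rule power2_le_imp_le) (simp add: mnorm_l2_nonneg)
qed

lemma finite_support_l2:
  assumes "finite I" "\<And>i. i \<in> I \<Longrightarrow> x i \<in> A" "\<And>i. i \<notin> I \<Longrightarrow> x i = 0"
  shows "x \<in> carr (l2 A)" and "ip (l2 A) x x = (\<Sum>i\<in>I. adj (x i) o\<^sub>L x i)"
proof -
  have zero: "adj (x i) o\<^sub>L x i = 0" if "i \<notin> I" for i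
    using assms(3)[OF that] by simp
  have "x i \<in> A" for i
    using assms(2,3)[of i] zero_mem by (cases "i \<in> I") auto
  then show "x \<in> carr (l2 A)"
    using summable_finite[OF assms(1) zero] by (simp add: carr_l2)
  show "ip (l2 A) x x = (\<Sum>i\<in>I. adj (x i) o\<^sub>L x i)"
    using suminf_finite[OF assms(1) zero] by simp
qed

lemma single_l2: "a \<in> A \<Longrightarrow> single k a \<in> carr (l2 A)"
  by (rule finite_support_l2[of "{k}"]) auto

lemma mnorm_single: "a \<in> A \<Longrightarrow> mnorm (l2 A) (single k a) = norm a"
  unfolding mnorm_def by (subst finite_support_l2(2)[of "{k}"])
    (auto simp: norm_adj_compose_self mem_BH)

lemma single_add: "single k (a + b) = single k a + single k (b :: 'h op)"
  by (simp add: single_def fun_eq_iff)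

lemma single_scaleC: "single k (c *\<^sub>C a) = c *\<^sub>C single k (a :: 'h op)"
proof -
  have "c *\<^sub>C (0 :: 'h op) = 0"
    by (rule blinfun_eqI)
      (simp add: linear_0[OF bounded_linear.linear, OF bounded_linear_scaleC])
  then show ?thesis
    by (simp add: single_def scaleC_fun_def fun_eq_iff)
qed

lemma bounded_hom_single: "bounded_hom A (alg_module A) (l2 A) (single k)"
  unfolding bounded_hom_def
proof (intro conjI ballI allI)
  show "\<exists>K. \<forall>x\<in>carr (alg_module A). mnorm (l2 A) (single k x) \<le> K * mnorm (alg_module A) x"
    by (rule exI[of _ 1]) (simp add: mnorm_single mnorm_alg_module)
qed (auto simp: single_l2 single_add single_scaleC, auto simp: single_def)

lemma bounded_hom_proj: "bounded_hom A (l2 A) (alg_module A) (proj k)"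
  unfolding bounded_hom_def
proof (intro conjI ballI allI)
  show "\<exists>K. \<forall>x\<in>carr (l2 A). mnorm (alg_module A) (proj k x) \<le> K * mnorm (l2 A) x"
    by (rule exI[of _ 1]) (simp add: proj_def mnorm_alg_module l2_mem norm_coordinate_le)
qed (auto simp: proj_def l2_mem scaleC_fun_def)

text \<open>A bounded functional is determined by its values on the coordinates, since the tails of an
  element of \<open>\<ell>\<^sup>2(A)\<close> tend to \<open>0\<close> in norm.\<close>

lemma functional_sums:
  assumes \<phi>: "bounded_hom A (l2 A) (alg_module A) \<phi>" and x: "x \<in> carr (l2 A)"
  shows "(\<lambda>i. \<phi> (single i (x i))) sums \<phi> x"
proof -
  obtain K where K: "K \<ge> 0" "\<And>x. x \<in> carr (l2 A) \<Longrightarrow> mnorm (alg_module A) (\<phi> x) \<le> K * mnorm (l2 A) x"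
    using bounded_hom_nonneg_bound[OF \<phi>] by blast
  have \<phi>_mem: "\<phi> y \<in> A" if "y \<in> carr (l2 A)" for y
    using \<phi> that by (simp add: bounded_hom_def)
  have \<phi>_add: "\<phi> (y + z) = \<phi> y + \<phi> z" if "y \<in> carr (l2 A)" "z \<in> carr (l2 A)" for y z
    using \<phi> that by (simp add: bounded_hom_def)
  define head where "head n = (\<lambda>i. if i < n then x i else 0)" for n
  define tail where "tail n = (\<lambda>i. if i < n then 0 else x i)" for n
  have head: "head n \<in> carr (l2 A)" for n
    by (rule finite_support_l2[of "{..<n}"]) (auto simp: head_def l2_mem[OF x])
  have tail_sums: "(\<lambda>i. adj (tail n i) o\<^sub>L tail n i) sums
      ((\<Sum>i. adj (x i) o\<^sub>L x i) - (\<Sum>i<n. adj (x i) o\<^sub>L x i))" for n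
  proof -
    have "(\<lambda>i. if i \<in> {..<n} then adj (x i) o\<^sub>L x i else 0) sums (\<Sum>i<n. adj (x i) o\<^sub>L x i)"
      by (rule sums_If_finite_set) simp
    from sums_diff[OF summable_sums[OF l2_summable[OF x]] this] show ?thesis
      by (rule back_subst[where P="\<lambda>f. f sums _"]) (auto simp: tail_def)
  qed
  have tail: "tail n \<in> carr (l2 A)" for n
    using tail_sums[of n] l2_mem[OF x] by (auto simp: carr_l2 sums_iff tail_def zero_mem)
  have "(\<lambda>n. K * sqrt (norm ((\<Sum>i. adj (x i) o\<^sub>L x i) - (\<Sum>i<n. adj (x i) o\<^sub>L x i))))
      \<longlonglongrightarrow> K * sqrt (norm ((\<Sum>i. adj (x i) o\<^sub>L x i) - (\<Sum>i. adj (x i) o\<^sub>L x i)))"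
    by (intro tendsto_intros summable_LIMSEQ l2_summable[OF x])
  then have lim: "(\<lambda>n. K * mnorm (l2 A) (tail n)) \<longlonglongrightarrow> 0"
    using tail_sums by (simp add: mnorm_l2 sums_iff)
  have "head 0 + head 0 = head 0"
    by (simp add: head_def fun_eq_iff)
  then have "\<phi> (head 0) = \<phi> (head 0) + \<phi> (head 0)"
    using \<phi>_add[OF head[of 0] head[of 0]] by simp
  then have "\<phi> (head 0) = 0"
    by simp
  moreover have "\<phi> (head (Suc n)) = \<phi> (head n) + \<phi> (single n (x n))" for n
  proof -
    have "head (Suc n) = head n + single n (x n)"
      by (auto simp: head_def single_def fun_eq_iff)
    then show ?thesis
      by (simp add: \<phi>_add head single_l2 l2_mem[OF x])
  qed
  ultimately have partial: "(\<Sum>i<n. \<phi> (single i (x i))) = \<phi> (head n)" for n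
    by (induction n) simp_all
  have "norm ((\<Sum>i<n. \<phi> (single i (x i))) - \<phi> x) \<le> K * mnorm (l2 A) (tail n)" for n
  proof -
    have "x = head n + tail n"
      by (auto simp: head_def tail_def)
    then have "\<phi> x = \<phi> (head n) + \<phi> (tail n)"
      using \<phi>_add[OF head tail] by metis
    then have "norm ((\<Sum>i<n. \<phi> (single i (x i))) - \<phi> x) = norm (\<phi> (tail n))"
      by (simp add: partial)
    also have "\<dots> \<le> K * mnorm (l2 A) (tail n)"
      using K(2)[OF tail] by (simp add: mnorm_alg_module \<phi>_mem tail)
    finally show ?thesis .
  qed
  then have "(\<lambda>n. (\<Sum>i<n. \<phi> (single i (x i))) - \<phi> x) \<longlonglongrightarrow> 0"
    by (intro Lim_null_comparison[OF _ lim] always_eventually allI)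
  then show ?thesis
    unfolding sums_def by (rule Lim_null[THEN iffD2])
qed

section \<open>Coefficients of functionals\<close>

text \<open>The coefficient \<open>\<Gamma> i\<close> is the adjoint of the left multiplier of \<open>a \<mapsto> \<phi> (single i a)\<close>. Let \<open>P\<close> be
  a partial sum of \<open>\<Sum>\<^sub>i \<Gamma>\<^sub>i\<^sup>* \<Gamma>\<^sub>i\<close>. Applying \<open>\<phi>\<close> to the finite sequences \<open>(u \<Gamma>\<^sub>i)\<^sub>i\<close>, whose norm is at
  most \<open>2 \<surd>\<parallel>P\<parallel>\<close>, and letting \<open>u\<close> run through the approximate unit gives
  \<open>\<parallel>P\<parallel> \<le> 2 K \<surd>\<parallel>P\<parallel>\<close>, so that \<open>\<parallel>P\<parallel> \<le> 4 K\<^sup>2\<close>.\<close>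

lemma coefficients_exist:
  assumes \<phi>: "bounded_hom A (l2 A) (alg_module A) \<phi>"
  obtains \<Gamma> C where "is_coefficients A \<phi> \<Gamma>" "C \<ge> 0" "column_bounded C \<Gamma>"
proof -
  obtain K where K: "K \<ge> 0" "\<And>x. x \<in> carr (l2 A) \<Longrightarrow> mnorm (alg_module A) (\<phi> x) \<le> K * mnorm (l2 A) x"
    using bounded_hom_nonneg_bound[OF \<phi>] by blast
  have \<phi>_mem: "\<phi> y \<in> A" if "y \<in> carr (l2 A)" for y
    using \<phi> that by (simp add: bounded_hom_def)
  have "\<exists>T\<in>LM A. \<forall>a\<in>A. \<phi> (single i a) = T o\<^sub>L a" for i
    using left_multiplier_exists[OF bounded_hom_compose[OF bounded_hom_single[of i] \<phi>]]
    by (metis comp_apply)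
  then obtain T where T: "\<And>i. T i \<in> LM A" "\<And>i a. a \<in> A \<Longrightarrow> \<phi> (single i a) = T i o\<^sub>L a"
    by metis
  define \<Gamma> where "\<Gamma> i = adj (T i)" for i
  have \<Gamma>_RM: "\<Gamma> i \<in> RM A" for i
    by (simp add: \<Gamma>_def adj_LM T)
  have \<Gamma>_BH: "\<Gamma> i \<in> BH" for i
    using \<Gamma>_RM by (rule RM_BH)
  have adj_\<Gamma>: "adj (\<Gamma> i) = T i" for i
    by (simp add: \<Gamma>_def LM_BH T)
  have \<phi>_sums: "(\<lambda>i. adj (\<Gamma> i) o\<^sub>L x i) sums \<phi> x" if x: "x \<in> carr (l2 A)" for x
    using functional_sums[OF \<phi> x] by (simp add: T l2_mem[OF x] adj_\<Gamma>)
  have "column_bounded (2 * K) \<Gamma>"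
  proof (subst column_bounded_iff_partial_sums[OF \<Gamma>_BH], safe)
    fix n
    let ?P = "\<Sum>i<n. adj (\<Gamma> i) o\<^sub>L \<Gamma> i"
    define s where "s = sqrt (norm ?P)"
    have s: "s \<ge> 0" "norm ?P = s\<^sup>2"
      by (simp_all add: s_def)
    have bound_u: "norm (\<Sum>i<n. T i o\<^sub>L (u o\<^sub>L \<Gamma> i)) \<le> K * (2 * s)" if u: "u \<in> A" "norm u \<le> 2" for u
    proof -
      define x where "x i = (if i < n then u o\<^sub>L \<Gamma> i else 0)" for i
      have x_mem: "u o\<^sub>L \<Gamma> i \<in> A" for i
        using \<Gamma>_RM[of i] u(1) by (simp add: RM_def)
      have x: "x \<in> carr (l2 A)"
        by (rule finite_support_l2(1)[of "{..<n}"]) (auto simp: x_def x_mem)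
      have "\<phi> x = (\<Sum>i<n. T i o\<^sub>L (u o\<^sub>L \<Gamma> i))"
      proof -
        have "(\<lambda>i. adj (\<Gamma> i) o\<^sub>L x i) sums (\<Sum>i<n. adj (\<Gamma> i) o\<^sub>L x i)"
          by (rule sums_finite) (auto simp: x_def)
        then have "\<phi> x = (\<Sum>i<n. adj (\<Gamma> i) o\<^sub>L x i)"
          using \<phi>_sums[OF x] sums_unique2 by blast
        then show ?thesis
          by (simp add: adj_\<Gamma> x_def)
      qed
      then have "norm (\<Sum>i<n. T i o\<^sub>L (u o\<^sub>L \<Gamma> i)) \<le> K * mnorm (l2 A) x"
        using K(2)[OF x] \<phi>_mem[OF x] by (simp add: mnorm_alg_module)
      also have "mnorm (l2 A) x \<le> 2 * s"
      proof -
        have "column_bounded (2 * s) x"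
          unfolding column_bounded_def
        proof (intro conjI allI)
          show "x i \<in> BH" for i
            using l2_mem[OF x] mem_BH by blast
          fix m h
          have "(\<Sum>i<m. (norm (blinfun_apply (x i) h))\<^sup>2)
              \<le> (\<Sum>i<m. if i < n then 4 * (norm (blinfun_apply (\<Gamma> i) h))\<^sup>2 else 0)"
          proof (rule sum_mono)
            fix i
            have "norm (blinfun_apply u (blinfun_apply (\<Gamma> i) h)) \<le> 2 * norm (blinfun_apply (\<Gamma> i) h)"
              using mult_right_mono[OF u(2) norm_ge_zero]
              by (rule order_trans[OF norm_blinfun])
            from power_mono[OF this norm_ge_zero, of 2]
            show "(norm (blinfun_apply (x i) h))\<^sup>2
                \<le> (if i < n then 4 * (norm (blinfun_apply (\<Gamma> i) h))\<^sup>2 else 0)"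
              by (simp add: x_def power_mult_distrib)
          qed
          also have "\<dots> = (\<Sum>i\<in>{..<m} \<inter> {..<n}. 4 * (norm (blinfun_apply (\<Gamma> i) h))\<^sup>2)"
            by (subst sum.inter_restrict) auto
          also have "\<dots> \<le> (\<Sum>i<n. 4 * (norm (blinfun_apply (\<Gamma> i) h))\<^sup>2)"
            by (rule sum_mono2) auto
          also have "\<dots> = 4 * (\<Sum>i<n. (norm (blinfun_apply (\<Gamma> i) h))\<^sup>2)"
            by (simp add: sum_distrib_left)
          also have "\<dots> \<le> 4 * (norm ?P * (norm h)\<^sup>2)"
            by (intro mult_left_mono sum_norm_le_norm_sum_adj_compose \<Gamma>_BH) simp
          also have "\<dots> = (2 * s * norm h)\<^sup>2"
            by (simp add: s power_mult_distrib)
          finally show "(\<Sum>i<m. (norm (blinfun_apply (x i) h))\<^sup>2) \<le> (2 * s * norm h)\<^sup>2" .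
        qed
        then have "norm (\<Sum>i<n. adj (x i) o\<^sub>L x i) \<le> (2 * s)\<^sup>2"
          using s(1) by (intro norm_sum_adj_compose_le) auto
        moreover have "ip (l2 A) x x = (\<Sum>i<n. adj (x i) o\<^sub>L x i)"
          by (rule finite_support_l2(2)) (auto simp: x_def x_mem)
        ultimately show ?thesis
          using s(1) unfolding mnorm_def by (intro real_le_lsqrt) simp_all
      qed
      finally show ?thesis
        using K(1) by (simp add: mult_left_mono)
    qed
    have "norm ?P \<le> K * (2 * s)"
    proof (rule norm_blinfun_bound)
      fix h
      have "((\<lambda>u. norm (\<Sum>i<n. blinfun_apply (T i) (blinfun_apply u (blinfun_apply (\<Gamma> i) h)))) \<longlongrightarrow>
          norm (\<Sum>i<n. blinfun_apply (T i) (blinfun_apply (\<Gamma> i) h))) approx_unit"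
        by (intro tendsto_norm tendsto_sum blinfun.tendsto tendsto_const tendsto_approx_unit)
      moreover have "\<forall>\<^sub>F u in approx_unit.
          norm (\<Sum>i<n. blinfun_apply (T i) (blinfun_apply u (blinfun_apply (\<Gamma> i) h))) \<le> K * (2 * s) * norm h"
        using eventually_approx_unit_mem
      proof eventually_elim
        case (elim u)
        have "norm (blinfun_apply (\<Sum>i<n. T i o\<^sub>L (u o\<^sub>L \<Gamma> i)) h) \<le> K * (2 * s) * norm h"
          using elim by (intro order_trans[OF norm_blinfun] mult_right_mono bound_u) auto
        then show ?case
          by (simp add: blinfun.sum_left)
      qed
      ultimately have "norm (\<Sum>i<n. blinfun_apply (T i) (blinfun_apply (\<Gamma> i) h)) \<le> K * (2 * s) * norm h"
        by (rule tendsto_upperbound) (rule approx_unit_not_bot)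
      then show "norm (blinfun_apply ?P h) \<le> K * (2 * s) * norm h"
        by (simp add: blinfun.sum_left adj_\<Gamma>)
    qed (use K s in simp)
    then have "s * s \<le> (2 * K) * s"
      by (simp add: s(2) power2_eq_square mult_ac)
    then have "s \<le> 2 * K"
      using s(1) K(1) by (cases "s = 0") auto
    then show "norm ?P \<le> (2 * K)\<^sup>2"
      unfolding s(2) using s(1) by (rule power_mono)
  qed (use K in simp)
  moreover from this have "strongly_summable (\<lambda>i. adj (\<Gamma> i) o\<^sub>L \<Gamma> i)"
    using K(1) unfolding strongly_summable_def
    by (elim column_bounded_strong_sum) auto
  ultimately show thesis
    using that[of \<Gamma> "2 * K"] \<Gamma>_RM \<phi>_sums K(1) by (simp add: is_coefficients_def)
qed

lemma coefficients_single:
  assumes "is_coefficients A \<phi> \<Gamma>" "a \<in> A"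
  shows "adj (\<Gamma> i) o\<^sub>L a = \<phi> (single i a)"
proof -
  have "(\<lambda>j. adj (\<Gamma> j) o\<^sub>L single i a j) sums \<phi> (single i a)"
    using assms single_l2 by (simp add: is_coefficients_def)
  moreover have "(\<lambda>j. adj (\<Gamma> j) o\<^sub>L single i a j) sums (\<Sum>j\<in>{i}. adj (\<Gamma> j) o\<^sub>L single i a j)"
    by (rule sums_finite) auto
  ultimately show ?thesis
    by (simp add: sums_iff)
qed

lemma coefficients_unique:
  assumes "is_coefficients A \<phi> \<Gamma>" "is_coefficients A \<phi> \<Gamma>'"
  shows "\<Gamma> = \<Gamma>'"
proof
  fix i
  have "adj (\<Gamma> i) = adj (\<Gamma>' i)"
    by (rule eq_if_compose_eq) (simp add: coefficients_single[OF assms(1)] coefficients_single[OF assms(2)])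
  moreover have "\<Gamma> i \<in> BH" "\<Gamma>' i \<in> BH"
    using assms by (auto simp: is_coefficients_def RM_BH)
  ultimately show "\<Gamma> i = \<Gamma>' i"
    by (metis adj_adj)
qed

text \<open>By uniqueness the row is the sequence constructed above and inherits its column bound; this is
  the boundedness required of an element of the dual of the multiplier module.\<close>

lemma matrix_row_coefficients:
  assumes F: "bounded_hom A (l2 A) (l2 A) F"
  shows "is_coefficients A (proj k \<circ> F) (matrix_row A F k)"
    and "\<exists>C\<ge>0. column_bounded C (matrix_row A F k)"
proof -
  obtain \<Gamma> C where \<Gamma>: "is_coefficients A (proj k \<circ> F) \<Gamma>" "C \<ge> 0" "column_bounded C \<Gamma>"
    using coefficients_exist[OF bounded_hom_compose[OF F bounded_hom_proj]] by blast
  have "matrix_row A F k = \<Gamma>"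
    unfolding matrix_row_def by (rule the_equality) (use \<Gamma>(1) coefficients_unique in blast)+
  then show "is_coefficients A (proj k \<circ> F) (matrix_row A F k)"
    and "\<exists>C\<ge>0. column_bounded C (matrix_row A F k)"
    using \<Gamma> by auto
qed

end

section \<open>Adjointable maps into the standard module\<close>

context represented_cstar_algebra
begin

lemma adjointable_proj:
  assumes \<gamma>: "adjointable A (alg_module A) (l2 A) \<gamma>"
  shows "adjointable A (alg_module A) (alg_module A) (proj k \<circ> \<gamma>)"
proof -
  have hom: "bounded_hom A (alg_module A) (l2 A) \<gamma>"
    using \<gamma> by (simp add: adjointable_def)
  obtain G where G: "\<And>y. y \<in> carr (l2 A) \<Longrightarrow> G y \<in> A"
    "\<And>x y. x \<in> A \<Longrightarrow> y \<in> carr (l2 A) \<Longrightarrow> ip (l2 A) (\<gamma> x) y = adj x o\<^sub>L G y"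
    using \<gamma> unfolding adjointable_def alg_module_simps by blast
  have "adj (\<gamma> x k) o\<^sub>L y = adj x o\<^sub>L G (single k y)" if "x \<in> A" "y \<in> A" for x y
  proof -
    have "ip (l2 A) (\<gamma> x) (single k y) = (\<Sum>i\<in>{k}. adj (\<gamma> x i) o\<^sub>L single k y i)"
      unfolding l2_simps by (rule suminf_finite) auto
    then show ?thesis
      using G(2)[OF that(1) single_l2[OF that(2)]] by simp
  qed
  then show ?thesis
    unfolding adjointable_def
    by (intro conjI bounded_hom_compose[OF hom bounded_hom_proj] exI[of _ "\<lambda>y. G (single k y)"])
      (auto simp: proj_def G single_l2)
qed

text \<open>Testing \<open>\<gamma>\<close> on the approximate unit shows that the column of its coefficients is bounded.\<close>

lemma column_bounded_coefficients:
  assumes \<gamma>: "bounded_hom A (alg_module A) (l2 A) \<gamma>"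
    and \<beta>: "\<And>i. \<beta> i \<in> BH" "\<And>a i. a \<in> A \<Longrightarrow> \<gamma> a i = \<beta> i o\<^sub>L a"
  obtains C where "C \<ge> 0" "column_bounded C \<beta>"
proof -
  obtain K where K: "K \<ge> 0" "\<And>a. a \<in> A \<Longrightarrow> mnorm (l2 A) (\<gamma> a) \<le> K * norm a"
    using bounded_hom_nonneg_bound[OF \<gamma>] by (metis alg_module_simps(1) mnorm_alg_module)
  have \<gamma>_mem: "\<gamma> a \<in> carr (l2 A)" if "a \<in> A" for a
    using \<gamma> that by (simp add: bounded_hom_def)
  have "column_bounded (2 * K) \<beta>"
    unfolding column_bounded_def
  proof (intro conjI allI \<beta>)
    fix n h
    have "((\<lambda>u. \<Sum>i<n. (norm (blinfun_apply (\<beta> i) (blinfun_apply u h)))\<^sup>2) \<longlongrightarrow>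
        (\<Sum>i<n. (norm (blinfun_apply (\<beta> i) h))\<^sup>2)) approx_unit"
      by (intro tendsto_intros blinfun.tendsto tendsto_const tendsto_approx_unit)
    moreover have "\<forall>\<^sub>F u in approx_unit.
        (\<Sum>i<n. (norm (blinfun_apply (\<beta> i) (blinfun_apply u h)))\<^sup>2) \<le> (2 * K * norm h)\<^sup>2"
      using eventually_approx_unit_mem
    proof eventually_elim
      case (elim u)
      have "(\<Sum>i<n. (norm (blinfun_apply (\<beta> i) (blinfun_apply u h)))\<^sup>2)
          = (\<Sum>i<n. (norm (blinfun_apply (\<gamma> u i) h))\<^sup>2)"
        using elim by (simp add: \<beta>)
      also have "\<dots> \<le> (mnorm (l2 A) (\<gamma> u) * norm h)\<^sup>2"
        using elim by (intro column_bounded_finite l2_column_bounded \<gamma>_mem) auto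
      also have "\<dots> \<le> (2 * K * norm h)\<^sup>2"
      proof (intro power_mono mult_right_mono)
        have "mnorm (l2 A) (\<gamma> u) \<le> K * norm u"
          using elim K by blast
        also have "\<dots> \<le> K * 2"
          using elim by (intro mult_left_mono K) blast
        finally show "mnorm (l2 A) (\<gamma> u) \<le> 2 * K"
          by simp
      qed (simp_all add: mnorm_l2_nonneg)
      finally show ?case .
    qed
    ultimately show "(\<Sum>i<n. (norm (blinfun_apply (\<beta> i) h))\<^sup>2) \<le> (2 * K * norm h)\<^sup>2"
      by (rule tendsto_upperbound) (rule approx_unit_not_bot)
  qed
  then show thesis
    using that[of "2 * K"] K by simp
qed

text \<open>The adjoint of \<open>\<gamma>\<close> is \<open>y \<mapsto> \<Sum>\<^sub>i \<beta>\<^sub>i\<^sup>* y\<^sub>i\<close>; this series converges in norm because a bounded row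
  maps sequences in \<open>\<ell>\<^sup>2(A)\<close> to norm-convergent series. Taking \<open>y = \<gamma> a\<close> gives the strict
  convergence of \<open>\<Sum>\<^sub>i \<beta>\<^sub>i\<^sup>* \<beta>\<^sub>i\<close>.\<close>

lemma multiplier_column:
  assumes \<gamma>: "bounded_hom A (alg_module A) (l2 A) \<gamma>"
    and \<beta>: "\<And>i. \<beta> i \<in> Mult A" "\<And>a i. a \<in> A \<Longrightarrow> \<gamma> a i = \<beta> i o\<^sub>L a"
  shows "adjointable A (alg_module A) (l2 A) \<gamma>" and "\<beta> \<in> multiplier_l2 A"
proof -
  have \<beta>_BH: "\<beta> i \<in> BH" for i
    using \<beta>(1) by (rule Mult_BH)
  obtain C where C: "C \<ge> 0" "column_bounded C \<beta>"
    using column_bounded_coefficients[OF \<gamma> \<beta>_BH \<beta>(2)] by blast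
  have \<gamma>_mem: "\<gamma> a \<in> carr (l2 A)" if "a \<in> A" for a
    using \<gamma> that by (simp add: bounded_hom_def)
  have row_sums: "(\<lambda>i. adj (\<beta> i) o\<^sub>L y i) sums (\<Sum>i. adj (\<beta> i) o\<^sub>L y i)" if y: "y \<in> carr (l2 A)" for y
    by (intro summable_sums summable_row_times_column[OF C(2,1)] l2_summable mem_BH l2_mem y)
  have row_mem: "(\<Sum>i. adj (\<beta> i) o\<^sub>L y i) \<in> A" if y: "y \<in> carr (l2 A)" for y
  proof (rule sums_mem[OF row_sums[OF y]])
    show "adj (\<beta> i) o\<^sub>L y i \<in> A" for i
      using adj_Mult[OF \<beta>(1)[of i]] l2_mem[OF y, of i] by (auto simp: Mult_def LM_def)
  qed
  have "ip (l2 A) (\<gamma> x) y = adj x o\<^sub>L (\<Sum>i. adj (\<beta> i) o\<^sub>L y i)" if x: "x \<in> A" and y: "y \<in> carr (l2 A)" for x y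
  proof -
    have "(\<lambda>i. adj x o\<^sub>L (adj (\<beta> i) o\<^sub>L y i)) sums (adj x o\<^sub>L (\<Sum>i. adj (\<beta> i) o\<^sub>L y i))"
      by (rule sums_compose_left[OF row_sums[OF y]])
    moreover have "adj x o\<^sub>L (adj (\<beta> i) o\<^sub>L y i) = adj (\<gamma> x i) o\<^sub>L y i" for i
      by (simp add: \<beta>(2) x adj_compose \<beta>_BH mem_BH compose_assoc)
    ultimately show ?thesis
      by (simp add: sums_iff)
  qed
  then show "adjointable A (alg_module A) (l2 A) \<gamma>"
    unfolding adjointable_def alg_module_simps
    by (intro conjI exI[of _ "\<lambda>y. \<Sum>i. adj (\<beta> i) o\<^sub>L y i"] \<gamma>) (auto simp: row_mem)
  obtain T where T: "T \<in> BH" "adj T = T"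
    "\<And>h. (\<lambda>i. blinfun_apply (adj (\<beta> i) o\<^sub>L \<beta> i) h) sums blinfun_apply T h"
    using column_bounded_strong_sum[OF C(2,1)] by blast
  have right: "(\<lambda>i. (adj (\<beta> i) o\<^sub>L \<beta> i) o\<^sub>L a) sums (T o\<^sub>L a)" and T_A: "T o\<^sub>L a \<in> A" if a: "a \<in> A" for a
  proof -
    let ?s = "\<Sum>i. adj (\<beta> i) o\<^sub>L \<gamma> a i"
    have s: "(\<lambda>i. (adj (\<beta> i) o\<^sub>L \<beta> i) o\<^sub>L a) sums ?s"
      using row_sums[OF \<gamma>_mem[OF a]] by (simp add: \<beta>(2) a compose_assoc)
    have "?s = T o\<^sub>L a"
    proof (rule blinfun_eqI)
      fix h
      have "(\<lambda>i. blinfun_apply ((adj (\<beta> i) o\<^sub>L \<beta> i) o\<^sub>L a) h) sums blinfun_apply ?s h"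
        by (rule bounded_linear.sums[OF blinfun.bounded_linear_left s])
      then show "blinfun_apply ?s h = blinfun_apply (T o\<^sub>L a) h"
        using T(3)[of "blinfun_apply a h"] by (simp add: sums_iff)
    qed
    then show "(\<lambda>i. (adj (\<beta> i) o\<^sub>L \<beta> i) o\<^sub>L a) sums (T o\<^sub>L a)" "T o\<^sub>L a \<in> A"
      using s row_mem[OF \<gamma>_mem[OF a]] by simp_all
  qed
  have "T \<in> LM A"
    using T(1) T_A by (simp add: LM_def)
  then have "T \<in> Mult A"
    using adj_LM[of T] T(2) by (simp add: Mult_def)
  moreover have "(\<lambda>i. a o\<^sub>L (adj (\<beta> i) o\<^sub>L \<beta> i)) sums (a o\<^sub>L T)" if a: "a \<in> A" for a
  proof -
    have "(\<lambda>i. adj ((adj (\<beta> i) o\<^sub>L \<beta> i) o\<^sub>L adj a)) sums adj (T o\<^sub>L adj a)"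
      by (intro adj_sums right adj_mem a compose_BH adj_BH \<beta>_BH T mem_BH)
    then show ?thesis
      by (simp add: adj_compose compose_BH adj_BH \<beta>_BH T mem_BH a)
  qed
  ultimately show "\<beta> \<in> multiplier_l2 A"
    using \<beta>(1) right unfolding multiplier_l2_def strict_sums_def by blast
qed

text \<open>Components with multiplier coefficients suffice for adjointability, since boundedness of the whole
  column then comes from boundedness of \<open>\<gamma>\<close>.\<close>

lemma adjointable_standard_module_iff:
  assumes \<gamma>: "bounded_hom A (alg_module A) (l2 A) \<gamma>"
  shows "adjointable A (alg_module A) (l2 A) \<gamma> \<longleftrightarrow>
    (\<forall>k. adjointable A (alg_module A) (alg_module A) (proj k \<circ> \<gamma>))" (is "?L \<longleftrightarrow> ?R")
    and "adjointable A (alg_module A) (l2 A) \<gamma> \<Longrightarrow>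
    \<exists>\<beta>\<in>multiplier_l2 A. \<forall>a\<in>A. \<gamma> a = (\<lambda>i. \<beta> i o\<^sub>L a)"
proof -
  have *: "?L \<and> (\<exists>\<beta>\<in>multiplier_l2 A. \<forall>a\<in>A. \<gamma> a = (\<lambda>i. \<beta> i o\<^sub>L a))" if ?R
  proof -
    have "\<forall>i. \<exists>T\<in>Mult A. \<forall>a\<in>A. \<gamma> a i = T o\<^sub>L a"
      using that unfolding adjointable_algebra_iff by (simp add: proj_def)
    then obtain \<beta> where \<beta>: "\<And>i. \<beta> i \<in> Mult A" "\<And>a i. a \<in> A \<Longrightarrow> \<gamma> a i = \<beta> i o\<^sub>L a"
      by metis
    from multiplier_column[OF \<gamma> \<beta>] \<beta>(2) show ?thesis
      by blast
  qed
  then show "?L \<longleftrightarrow> ?R"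
    using adjointable_proj by blast
  show "\<exists>\<beta>\<in>multiplier_l2 A. \<forall>a\<in>A. \<gamma> a = (\<lambda>i. \<beta> i o\<^sub>L a)" if ?L
    using * adjointable_proj[OF that] by blast
qed

text \<open>If \<open>T\<close> is the strict sum of \<open>\<beta>\<^sub>i\<^sup>* \<beta>\<^sub>i\<close>, then \<open>\<parallel>(\<beta>\<^sub>i a)\<^sub>i\<parallel>\<^sup>2 = \<parallel>a\<^sup>* T a\<parallel> \<le> \<parallel>T\<parallel> \<parallel>a\<parallel>\<^sup>2\<close>; hence
  \<open>\<beta>\<close> gives a bounded map into \<open>\<ell>\<^sup>2(A)\<close>.\<close>

lemma adjointable_multiplier_l2:
  assumes \<beta>: "\<beta> \<in> multiplier_l2 A"
  shows "adjointable A (alg_module A) (l2 A) (\<lambda>a i. \<beta> i o\<^sub>L a)"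
proof (rule multiplier_column(1))
  obtain T where T: "T \<in> Mult A" "\<And>a. a \<in> A \<Longrightarrow> (\<lambda>i. (adj (\<beta> i) o\<^sub>L \<beta> i) o\<^sub>L a) sums (T o\<^sub>L a)"
    using \<beta> unfolding multiplier_l2_def strict_sums_def by blast
  show \<beta>_Mult: "\<beta> i \<in> Mult A" for i
    using \<beta> by (simp add: multiplier_l2_def)
  have mem: "\<beta> i o\<^sub>L a \<in> A" if "a \<in> A" for i a
    using \<beta>_Mult[of i] that by (simp add: Mult_def LM_def)
  have self: "(\<lambda>i. adj (\<beta> i o\<^sub>L a) o\<^sub>L (\<beta> i o\<^sub>L a)) sums (adj a o\<^sub>L (T o\<^sub>L a))" if a: "a \<in> A" for a
    using sums_compose_left[OF T(2)[OF a], of "adj a"]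
    by (simp add: adj_compose Mult_BH \<beta>_Mult mem_BH a compose_assoc)
  show "bounded_hom A (alg_module A) (l2 A) (\<lambda>a i. \<beta> i o\<^sub>L a)"
    unfolding bounded_hom_def alg_module_simps
  proof (intro conjI ballI allI)
    fix x y c
    assume x: "x \<in> A"
    show "(\<lambda>i. \<beta> i o\<^sub>L x) \<in> carr (l2 A)"
      using self[OF x] by (auto simp: carr_l2 mem x sums_iff)
    show "(\<lambda>i. \<beta> i o\<^sub>L (c *\<^sub>C x)) = c *\<^sub>C (\<lambda>i. \<beta> i o\<^sub>L x)"
      by (auto simp: scaleC_fun_def BH_scaleC Mult_BH \<beta>_Mult intro!: blinfun_eqI ext)
    show "(\<lambda>i. \<beta> i o\<^sub>L (x + y)) = (\<lambda>i. \<beta> i o\<^sub>L x) + (\<lambda>i. \<beta> i o\<^sub>L y)"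
      by (simp add: compose_add_right fun_eq_iff)
    show "(\<lambda>i. \<beta> i o\<^sub>L (x o\<^sub>L y)) = act (l2 A) (\<lambda>i. \<beta> i o\<^sub>L x) y"
      by (simp add: compose_assoc)
  next
    have "mnorm (l2 A) (\<lambda>i. \<beta> i o\<^sub>L x) \<le> sqrt (norm T) * mnorm (alg_module A) x" if x: "x \<in> A" for x
    proof -
      have "norm (adj x o\<^sub>L (T o\<^sub>L x)) \<le> norm x * (norm T * norm x)"
        using x by (intro order_trans[OF norm_blinfun_compose] mult_mono norm_blinfun_compose)
          (simp_all add: mem_BH)
      then have "sqrt (norm (adj x o\<^sub>L (T o\<^sub>L x))) \<le> sqrt (norm T * (norm x)\<^sup>2)"
        by (intro real_sqrt_le_mono) (simp add: power2_eq_square mult_ac)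
      then show ?thesis
        using self[OF x] by (simp add: mnorm_l2 mnorm_alg_module x sums_iff real_sqrt_mult)
    qed
    then show "\<exists>K. \<forall>x\<in>A. mnorm (l2 A) (\<lambda>i. \<beta> i o\<^sub>L x) \<le> K * mnorm (alg_module A) x"
      by blast
  qed
qed simp

section \<open>Local adjointability\<close>

text \<open>For each test map \<open>\<gamma>\<close> this is the characterisation of adjointable maps \<open>A \<rightarrow> \<ell>\<^sup>2(A)\<close> by their
  components, applied to \<open>F \<circ> \<gamma>\<close>.\<close>

lemma locally_adjointable_iff_projections:
  assumes F: "bounded_hom A M (l2 A) F"
  shows "locally_adjointable A M (l2 A) F \<longleftrightarrow>
    (\<forall>k. locally_adjointable A M (alg_module A) (proj k \<circ> F))"
proof -
  have "adjointable A (alg_module A) (l2 A) (F \<circ> \<gamma>) \<longleftrightarrow>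
      (\<forall>k. adjointable A (alg_module A) (alg_module A) ((proj k \<circ> F) \<circ> \<gamma>))"
    if "adjointable A (alg_module A) M \<gamma>" for \<gamma>
  proof -
    have "bounded_hom A (alg_module A) (l2 A) (F \<circ> \<gamma>)"
      using bounded_hom_compose F that by (auto simp: adjointable_def)
    from adjointable_standard_module_iff(1)[OF this] show ?thesis
      by (simp add: comp_assoc)
  qed
  then show ?thesis
    using F bounded_hom_compose[OF F bounded_hom_proj] unfolding locally_adjointable_def by blast
qed

text \<open>Under the correspondence between adjointable maps \<open>A \<rightarrow> \<ell>\<^sup>2(A)\<close> and elements \<open>\<beta>\<close> of the multiplier
  module, \<open>\<phi> \<circ> \<beta>\<close> is the map \<open>a \<mapsto> \<Sum>\<^sub>i \<Gamma>\<^sub>i\<^sup>* \<beta>\<^sub>i a\<close>. Its adjointability says that this is left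
  multiplication by a multiplier.\<close>

lemma locally_adjointable_functional_iff:
  assumes \<phi>: "bounded_hom A (l2 A) (alg_module A) \<phi>"
    and \<Gamma>: "is_coefficients A \<phi> \<Gamma>" and C: "C \<ge> 0" "column_bounded C \<Gamma>"
  shows "locally_adjointable A (l2 A) (alg_module A) \<phi> \<longleftrightarrow> \<Gamma> \<in> multiplier_l2_dual A"
proof -
  have \<Gamma>_RM: "\<Gamma> i \<in> RM A" for i
    using \<Gamma> by (simp add: is_coefficients_def)
  have \<phi>_sums: "(\<lambda>i. adj (\<Gamma> i) o\<^sub>L x i) sums \<phi> x" if "x \<in> carr (l2 A)" for x
    using \<Gamma> that by (simp add: is_coefficients_def)
  have column_mem: "(\<lambda>i. \<beta> i o\<^sub>L a) \<in> carr (l2 A)" if "\<beta> \<in> multiplier_l2 A" "a \<in> A" for \<beta> a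
    using adjointable_multiplier_l2[OF that(1)] that(2) by (auto simp: adjointable_def bounded_hom_def)
  have value_sums: "(\<lambda>i. (adj (\<Gamma> i) o\<^sub>L \<beta> i) o\<^sub>L a) sums \<phi> (\<lambda>i. \<beta> i o\<^sub>L a)"
    if "\<beta> \<in> multiplier_l2 A" "a \<in> A" for \<beta> a
    using \<phi>_sums[OF column_mem[OF that]] by (simp add: compose_assoc)
  have composite: "adjointable A (alg_module A) (alg_module A) (\<lambda>a. \<phi> (\<lambda>i. \<beta> i o\<^sub>L a)) \<longleftrightarrow>
      (\<exists>T\<in>Mult A. left_strict_sums A (\<lambda>i. adj (\<Gamma> i) o\<^sub>L \<beta> i) T)"
    if \<beta>: "\<beta> \<in> multiplier_l2 A" for \<beta>
  proof -
    have "\<phi> (\<lambda>i. \<beta> i o\<^sub>L a) = T o\<^sub>L a \<longleftrightarrow> (\<lambda>i. (adj (\<Gamma> i) o\<^sub>L \<beta> i) o\<^sub>L a) sums (T o\<^sub>L a)"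
      if "a \<in> A" for a T
      using value_sums[OF \<beta> that] by (auto simp: sums_iff)
    then show ?thesis
      unfolding adjointable_algebra_iff left_strict_sums_def by simp
  qed
  show ?thesis
  proof
    assume \<phi>_loc: "locally_adjointable A (l2 A) (alg_module A) \<phi>"
    have adjointable_composite:
      "adjointable A (alg_module A) (alg_module A) (\<lambda>a. \<phi> (\<lambda>i. \<beta> i o\<^sub>L a))"
      if "\<beta> \<in> multiplier_l2 A" for \<beta>
      using \<phi>_loc adjointable_multiplier_l2[OF that] by (auto simp: locally_adjointable_def comp_def)
    have "\<Gamma> i \<in> Mult A" for i
    proof -
      \<comment> \<open>\<open>\<Gamma> i\<close> is recovered from the embedding of \<open>A\<close> as the \<open>i\<close>-th coordinate\<close>
      have comps: "adjointable A (alg_module A) (alg_module A) (proj j \<circ> single i)" for j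
        unfolding adjointable_algebra_iff
        by (rule bexI[of _ "if j = i then id_blinfun else 0"])
          (auto simp: proj_def id_Mult zero_Mult intro: blinfun_eqI)
      have "adjointable A (alg_module A) (l2 A) (single i)"
        using adjointable_standard_module_iff(1)[OF bounded_hom_single] comps by blast
      then have "adjointable A (alg_module A) (alg_module A) (\<phi> \<circ> single i)"
        using \<phi>_loc by (simp add: locally_adjointable_def)
      then obtain T where T: "T \<in> Mult A" "\<And>a. a \<in> A \<Longrightarrow> \<phi> (single i a) = T o\<^sub>L a"
        unfolding adjointable_algebra_iff by auto
      have "adj (\<Gamma> i) = T"
        by (rule eq_if_compose_eq) (simp add: coefficients_single[OF \<Gamma>] T)
      then have "\<Gamma> i = adj T"
        using \<Gamma>_RM[of i] by (metis RM_BH adj_adj)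
      then show ?thesis
        using T by (simp add: adj_Mult)
    qed
    moreover have "bounded (range (\<lambda>n. \<Sum>i<n. adj (\<Gamma> i) o\<^sub>L \<Gamma> i))"
      using norm_sum_adj_compose_le[OF C(2,1)] by (intro boundedI[of _ "C\<^sup>2"]) auto
    ultimately show "\<Gamma> \<in> multiplier_l2_dual A"
      using composite adjointable_composite unfolding multiplier_l2_dual_def by blast
  next
    assume dual: "\<Gamma> \<in> multiplier_l2_dual A"
    have "adjointable A (alg_module A) (alg_module A) (\<phi> \<circ> \<gamma>)"
      if \<gamma>: "adjointable A (alg_module A) (l2 A) \<gamma>" for \<gamma>
    proof -
      obtain \<beta> where \<beta>: "\<beta> \<in> multiplier_l2 A" "\<And>a. a \<in> A \<Longrightarrow> \<gamma> a = (\<lambda>i. \<beta> i o\<^sub>L a)"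
        using adjointable_standard_module_iff(2) \<gamma> by (metis adjointable_def)
      have "adjointable A (alg_module A) (alg_module A) (\<lambda>a. \<phi> (\<lambda>i. \<beta> i o\<^sub>L a))"
        using composite[OF \<beta>(1)] dual \<beta>(1) by (simp add: multiplier_l2_dual_def)
      then show ?thesis
        unfolding adjointable_algebra_iff using \<beta>(2) by (metis comp_apply)
    qed
    then show "locally_adjointable A (l2 A) (alg_module A) \<phi>"
      using \<phi> by (simp add: locally_adjointable_def)
  qed
qed

end

theorem corollary12:
  fixes A :: "'h::chilbert_space op set"
  assumes "represented_cstar_algebra A"
  shows
    "(\<forall>(M :: ('m::complex_vector, 'h) cstar_module) F.
        hilbert_module A M \<longrightarrow> bounded_hom A M (l2 A) F \<longrightarrow>
        (locally_adjointable A M (l2 A) F \<longleftrightarrow>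
         (\<forall>k. locally_adjointable A M (alg_module A) (proj k \<circ> F)))) \<and>
     (\<forall>F. bounded_hom A (l2 A) (l2 A) F \<longrightarrow>
        (locally_adjointable A (l2 A) (l2 A) F \<longleftrightarrow>
         (\<forall>k. matrix_row A F k \<in> multiplier_l2_dual A)))"
proof (intro conjI allI impI)
  interpret represented_cstar_algebra A
    by fact
  fix M :: "('m, 'h) cstar_module" and F
  assume "bounded_hom A M (l2 A) F"
  then show "locally_adjointable A M (l2 A) F \<longleftrightarrow>
      (\<forall>k. locally_adjointable A M (alg_module A) (proj k \<circ> F))"
    by (rule locally_adjointable_iff_projections)
next
  interpret represented_cstar_algebra A
    by fact
  fix F
  assume F: "bounded_hom A (l2 A) (l2 A) F"
  have "locally_adjointable A (l2 A) (alg_module A) (proj k \<circ> F) \<longleftrightarrow>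
      matrix_row A F k \<in> multiplier_l2_dual A" for k
    using locally_adjointable_functional_iff[OF bounded_hom_compose[OF F bounded_hom_proj]]
      matrix_row_coefficients[OF F] by blast
  then show "locally_adjointable A (l2 A) (l2 A) F \<longleftrightarrow>
      (\<forall>k. matrix_row A F k \<in> multiplier_l2_dual A)"
    by (simp add: locally_adjointable_iff_projections[OF F])
qed

end
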